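(* For every $\alpha>\frac8\pi$ there exists a unique non-negative function $\zeta\in L^2$ satisfying the equation $\zeta=\varPhi(\zeta)$.
   Context: $L^2$ denotes $L^2(0,\pi/2)$ with norm $\|f\|=\big(\int_0^{\pi/2}|f(\sigma)|^2\,d\sigma\big)^{1/2}$. The kernel is $K(s,\sigma)=\log\Big|\frac{\sin(s+\sigma)}{\sin(s-\sigma)}\Big|$ for $s,\sigma\in(0,\pi/2)$, $s\neq\sigma$, and for $w\in L^2$ the operator $H$ is $(Hw)(\sigma)=\frac1\pi\int_0^{\pi/2}K(s,\sigma)\,w(s)\,ds$, $\sigma\in[0,\pi/2]$. For a parameter $\alpha>0$ (the reduced Froude number) the nonlinear operator $\varPhi$ is defined for $\zeta\in L^2$ by $$\varPhi(\zeta)(\sigma)=\frac{3}{\alpha\pi}\,\frac{\sin\big(\sigma+\frac13(H\zeta)(\sigma)\big)\cot\sigma}{\exp\int_0^\sigma\zeta(s)\,ds},\qquad\sigma\in(0,\pi/2].$$ *)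

theory Defs
  imports "HOL-Analysis.Analysis"
begin

text \<open>The underlying measure space: Lebesgue measure on the interval (0, pi/2).
  (Endpoints are a null set, so open/closed makes no difference.)\<close>
abbreviation I0 :: "real measure" where
  "I0 \<equiv> lebesgue_on {0<..<pi/2}"

definition L2 :: "(real \<Rightarrow> real) \<Rightarrow> bool" where
  "L2 f \<longleftrightarrow> f \<in> borel_measurable I0 \<and> integrable I0 (\<lambda>s. (f s)\<^sup>2)"

definition K :: "real \<Rightarrow> real \<Rightarrow> real" where
  "K s \<sigma> = ln \<bar>sin (s + \<sigma>) / sin (s - \<sigma>)\<bar>"

definition H :: "(real \<Rightarrow> real) \<Rightarrow> real \<Rightarrow> real" where
  "H w \<sigma> = (1 / pi) * (\<integral>s. K s \<sigma> * w s \<partial>I0)"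

definition Phi :: "real \<Rightarrow> (real \<Rightarrow> real) \<Rightarrow> real \<Rightarrow> real" where
  "Phi \<alpha> \<zeta> \<sigma> =
     (3 / (\<alpha> * pi)) * (sin (\<sigma> + (1/3) * H \<zeta> \<sigma>) * cot \<sigma>)
       / exp (\<integral>s. \<zeta> s \<partial>(lebesgue_on {0..\<sigma>}))"

end

theory Submission
  imports Defs "HOL-Real_Asymp.Real_Asymp"
begin

text \<open>For non-negative arguments, \<open>\<bar>Phi v - Phi w\<bar>\<close> is dominated pointwise by \<open>3 / (\<alpha> pi)\<close> times the integral
  operator applied to \<open>\<bar>v - w\<bar>\<close> whose kernel is \<open>cot t (K s t / (3 pi) + 1[s \<le> t])\<close>. In the variable
  \<open>tan s\<close> the kernel \<open>K\<close> becomes \<open>ln \<bar>(x + y) / (x - y)\<bar>\<close>, and the weight \<open>1 / sqrt (tan s)\<close> satisfies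
  the row and column conditions of the Schur test with constant \<open>2/3 + 2 = 8/3\<close>. Hence \<open>Phi\<close>
  contracts with factor \<open>8 / (\<alpha> pi) < 1\<close> both in \<open>L\<^sup>2\<close>, which gives uniqueness, and in the sup norm
  relative to the weight. The functions between 0 and the weight form an invariant set, on which
  iteration from 0 converges pointwise. The weight is not in \<open>L\<^sup>2\<close>, but the iterates stay in the
  unit ball of \<open>L\<^sup>2\<close>, so by Fatou's lemma the limit does too.\<close>

text \<open>With x = tan s and y = tan t the dominating kernel is homogeneous of degree -1. For such
  kernels the power x^(-1/2) is the natural Schur weight on L2(dx): by scaling, its row and column
  constants coincide. The substitution x = y u^2 turns the logarithmic row integral into 2 sqrt(y)
  times the integral of ln((1 + u^2) / |1 - u^2|) over (0, infinity), which is pi; divided by 3 pi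
  this gives the 2/3. The summand 2 is Hardy's constant. The true measure ds = dx / (1 + x^2) is
  bounded by dx. The obstacle to a fixed-point argument on all non-negative L2 functions is
  positivity: \<open>Phi \<alpha> w t\<close> is negative where t + H w t / 3 lies between pi and 2
  pi. Below the weight, H w is at most 2, which keeps the sine non-negative. Existence therefore
  runs in a smaller set, while uniqueness is argued among all non-negative solutions.\<close>

section \<open>A primitive of the logarithmic kernel\<close>

text \<open>The fundamental theorem of calculus gives the bound on compact subintervals, and Fatou's
  lemma carries it to the open interval. Because G enters only through the bounds A and B, no limit
  at an endpoint has to be computed, although \<open>sqrt_tan\<close> is unbounded at pi/2. The
  finite set S accommodates the logarithmic singularity on the diagonal.\<close>

lemma nn_integral_le_of_bounded_antiderivative:
  fixes f G :: "real \<Rightarrow> real"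
  assumes S: "finite S"
    and G': "\<And>x. x \<in> {a<..<b} - S \<Longrightarrow> (G has_real_derivative f x) (at x)"
    and contG: "continuous_on {a<..<b} G"
    and f: "f \<in> borel_measurable borel"
    and nonneg: "\<And>x. x \<in> {a<..<b} \<Longrightarrow> 0 \<le> f x"
    and G: "\<And>x. x \<in> {a<..<b} \<Longrightarrow> A \<le> G x \<and> G x \<le> B"
    and AB: "A \<le> B"
  shows "(\<integral>\<^sup>+x. ennreal (f x) * indicator {a<..<b} x \<partial>lebesgue) \<le> ennreal (B - A)"
proof -
  let ?J = "\<lambda>n::nat. {a + 1 / Suc n .. b - 1 / Suc n}"
  let ?f = "\<lambda>n x. ennreal (f x) * indicator (?J n) x"
  have le: "(\<integral>\<^sup>+x. ?f n x \<partial>lborel) \<le> ennreal (B - A)" for n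
  proof (cases "a + 1 / Suc n \<le> b - 1 / Suc n")
    case True
    have pos: "1 / real (Suc n) > 0" by simp
    have sub: "?J n \<subseteq> {a<..<b}" by (rule subsetI, unfold atLeastAtMost_iff greaterThanLessThan_iff) (use pos in linarith)
    have "(f has_integral (G (b - 1 / Suc n) - G (a + 1 / Suc n))) (?J n)"
      using sub True
      by (intro fundamental_theorem_of_calculus_interior_strong[OF S])
         (auto intro!: G' continuous_on_subset[OF contG] simp: has_real_derivative_iff_has_vector_derivative[symmetric] subset_eq)
    then have "(\<integral>\<^sup>+x. ?f n x \<partial>lborel) = ennreal (G (b - 1 / Suc n) - G (a + 1 / Suc n))"
      by (rule nn_integral_has_integral_lebesgue'[rotated]) (use sub nonneg in auto)
    also have "\<dots> \<le> ennreal (B - A)"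
      using G[of "b - 1 / Suc n"] G[of "a + 1 / Suc n"] sub True
      by (intro ennreal_leI) (auto simp: subset_eq)
    finally show ?thesis .
  next
    case False
    then have "?J n = {}" by auto
    then show ?thesis by (simp only:) simp
  qed
  have lim: "(\<lambda>n. ?f n x) \<longlonglongrightarrow> ennreal (f x) * indicator {a<..<b} x" for x
  proof (cases "x \<in> {a<..<b}")
    case True
    have "(\<lambda>n. 1 / real (Suc n)) \<longlonglongrightarrow> 0" by real_asymp
    then have "\<forall>\<^sub>F n in sequentially. 1 / real (Suc n) < min (x - a) (b - x)"
      by (rule order_tendstoD) (use True in auto)
    then have "\<forall>\<^sub>F n in sequentially. ?f n x = ennreal (f x) * indicator {a<..<b} x"
      by eventually_elim (use True in \<open>auto simp: indicator_def simp del: of_nat_Suc\<close>)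
    then show ?thesis by (rule tendsto_eventually)
  next
    case False
    have "x \<notin> ?J n" for n
    proof -
      have "1 / real (Suc n) > 0" by simp
      then show ?thesis
        using False unfolding atLeastAtMost_iff greaterThanLessThan_iff by linarith
    qed
    then show ?thesis using False by (simp del: atLeastAtMost_iff)
  qed
  have "(\<integral>\<^sup>+x. ennreal (f x) * indicator {a<..<b} x \<partial>lborel)
      = (\<integral>\<^sup>+x. liminf (\<lambda>n. ?f n x) \<partial>lborel)"
    by (intro nn_integral_cong lim_imp_Liminf[symmetric] lim) simp
  also have "\<dots> \<le> liminf (\<lambda>n. \<integral>\<^sup>+x. ?f n x \<partial>lborel)"
    using f by (intro nn_integral_liminf) auto
  also have "\<dots> \<le> ennreal (B - A)"
    by (rule Liminf_le) (auto simp: le simp del: of_nat_Suc)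
  finally show ?thesis
    using f by (subst nn_integral_completion) auto
qed

text \<open>A primitive of \<open>ln ((1 + u\<^sup>2) / \<bar>1 - u\<^sup>2\<bar>)\<close>, arranged so that the convention \<open>ln 0 = 0\<close>
  gives the continuous value at \<open>u = 1\<close>.\<close>

definition log_primitive :: "real \<Rightarrow> real" where
  "log_primitive u = u * ln (1 + u\<^sup>2) + (1 - u) * ln \<bar>1 - u\<bar> - (1 + u) * ln (1 + u) + 2 * arctan u"

lemma continuous_on_times_ln_abs: "continuous_on A (\<lambda>x::real. x * ln \<bar>x\<bar>)"
proof -
  have "isCont (\<lambda>x::real. x * ln \<bar>x\<bar>) x" for x
  proof (cases "x = 0")
    case True
    have "((\<lambda>x::real. x * ln \<bar>x\<bar>) \<longlongrightarrow> 0) (at_right 0)" by real_asymp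
    moreover have "((\<lambda>x::real. x * ln \<bar>x\<bar>) \<longlongrightarrow> 0) (at_left 0)" by real_asymp
    ultimately show ?thesis
      using True by (auto simp: isCont_def intro: filterlim_split_at)
  qed (auto intro!: continuous_intros)
  then show ?thesis by (simp add: continuous_at_imp_continuous_on)
qed

lemma continuous_on_log_primitive: "continuous_on {0..} log_primitive"
  unfolding log_primitive_def
  by (intro continuous_intros continuous_on_compose2[OF continuous_on_times_ln_abs[of UNIV]])
     (auto simp: add_nonneg_eq_0_iff)

lemma log_primitive_has_derivative:
  assumes "u > 0" "u \<noteq> 1"
  shows "(log_primitive has_real_derivative ln ((1 + u\<^sup>2) / \<bar>1 - u\<^sup>2\<bar>)) (at u)"
proof -
  have fac: "1 - u\<^sup>2 = (1 - u) * (1 + u)" by (simp add: algebra_simps power2_eq_square)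
  have pos: "1 + u\<^sup>2 > 0" by (simp add: add_pos_nonneg)
  have dab: "((\<lambda>x. (1 - x) * ln \<bar>1 - x\<bar>) has_real_derivative - ln \<bar>1 - u\<bar> - 1) (at u)"
  proof (cases "u < 1")
    case True
    have "((\<lambda>x. (1 - x) * ln (1 - x)) has_real_derivative - ln \<bar>1 - u\<bar> - 1) (at u)"
      using True by (auto intro!: derivative_eq_intros simp: field_simps)
    then show ?thesis
      by (rule DERIV_cong_ev[THEN iffD1, rotated 3])
         (use True eventually_nhds_in_open[of "{..<1}" u] in \<open>auto elim!: eventually_mono\<close>)
  next
    case False
    have "((\<lambda>x. (1 - x) * ln (x - 1)) has_real_derivative - ln \<bar>1 - u\<bar> - 1) (at u)"
      using False assms by (auto intro!: derivative_eq_intros simp: field_simps)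
    then show ?thesis
      by (rule DERIV_cong_ev[THEN iffD1, rotated 3])
         (use False assms eventually_nhds_in_open[of "{1<..}" u] in \<open>auto elim!: eventually_mono\<close>)
  qed
  have lnq: "ln ((1 + u\<^sup>2) / \<bar>1 - u\<^sup>2\<bar>) = ln (1 + u\<^sup>2) - ln \<bar>1 - u\<bar> - ln (1 + u)"
    using assms pos unfolding fac abs_mult by (simp add: ln_div ln_mult)
  have D: "(log_primitive has_real_derivative ln (1 + u\<^sup>2) + u * (2 * u / (1 + u\<^sup>2))
      + (- ln \<bar>1 - u\<bar> - 1) - (ln (1 + u) + 1) + 2 * (1 / (1 + u\<^sup>2))) (at u)"
    unfolding log_primitive_def using assms pos
    by (intro DERIV_add DERIV_diff DERIV_cmult dab)
       (auto intro!: derivative_eq_intros simp: divide_simps)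
  \<comment> \<open>The rational terms from u ln(1 + u^2) and 2 arctan u add up to 2 and cancel the
    two terms -1 left by the other products. This is the purpose of the arctan.\<close>
  have two: "u * (2 * u / (1 + u\<^sup>2)) + 2 * (1 / (1 + u\<^sup>2)) = 2"
  proof -
    have "u * (2 * u / (1 + u\<^sup>2)) + 2 * (1 / (1 + u\<^sup>2)) = 2 * (1 + u\<^sup>2) / (1 + u\<^sup>2)"
      by (simp add: add_divide_distrib power2_eq_square distrib_left)
    also have "\<dots> = 2" using pos by (subst nonzero_mult_div_cancel_right) auto
    finally show ?thesis .
  qed
  show ?thesis by (rule DERIV_cong[OF D]) (use lnq two in linarith)
qed

lemma log_ratio_nonneg:
  assumes "u > (0::real)"
  shows "ln ((1 + u\<^sup>2) / \<bar>1 - u\<^sup>2\<bar>) \<ge> 0"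
proof (cases "u\<^sup>2 = 1")
  case False
  then have "(1 + u\<^sup>2) / \<bar>1 - u\<^sup>2\<bar> \<ge> 1"
    by (auto simp: field_simps abs_if)
  then show ?thesis by simp
\<comment> \<open>At u = 1 the quotient is 2 / 0 = 0, and ln 0 = 0.\<close>
qed simp

lemma log_primitive_mono:
  assumes "0 \<le> u" "u \<le> v"
  shows "log_primitive u \<le> log_primitive v"
proof -
  \<comment> \<open>The derivative is available only away from 1, so monotonicity is shown on either
    side of 1 and the two pieces are joined there by continuity.\<close>
  have *: "log_primitive x \<le> log_primitive y" if "0 \<le> x" "x \<le> y" "1 \<le> x \<or> y \<le> 1" for x y
  proof (rule DERIV_nonneg_imp_increasing_open[OF that(2)])
    show "\<exists>D. (log_primitive has_real_derivative D) (at z) \<and> D \<ge> 0" if "x < z" "z < y" for z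
      using that \<open>0 \<le> x\<close> \<open>1 \<le> x \<or> y \<le> 1\<close> log_primitive_has_derivative[of z] log_ratio_nonneg[of z]
      by force
    show "continuous_on {x..y} log_primitive"
      by (rule continuous_on_subset[OF continuous_on_log_primitive]) (use \<open>0 \<le> x\<close> in auto)
  qed
  show ?thesis
    using *[of u v] *[of u 1] *[of 1 v] assms by linarith
qed

lemma log_primitive_bounds:
  assumes "0 \<le> u"
  shows "0 \<le> log_primitive u" "log_primitive u \<le> pi"
proof -
  have "log_primitive 0 = 0" by (simp add: log_primitive_def)
  then show "0 \<le> log_primitive u" using log_primitive_mono[of 0 u] assms by simp
  \<comment> \<open>At infinity the logarithmic terms cancel and 2 arctan u leaves 2 * (pi /
    2).\<close>
  have "(log_primitive \<longlongrightarrow> pi) at_top" unfolding log_primitive_def by real_asymp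
  then show "log_primitive u \<le> pi"
    by (rule tendsto_lowerbound)
       (use assms in \<open>auto simp: eventually_at_top_linorder intro!: exI[of _ u] log_primitive_mono\<close>)
qed

section \<open>Weighted integrals of the kernels\<close>

text \<open>The square root is taken as the basic quantity because its reciprocal is the Schur
  weight and because \<open>log_primitive\<close> is evaluated at the quotient
  \<open>sqrt_tan s / sqrt_tan t\<close>.\<close>

definition sqrt_tan :: "real \<Rightarrow> real" where
  "sqrt_tan s = sqrt (tan s)"

lemma sqrt_tan_pos [simp]: "0 < s \<Longrightarrow> s < pi / 2 \<Longrightarrow> 0 < sqrt_tan s"
  by (simp add: sqrt_tan_def tan_gt_zero)

lemma sqrt_tan_nonzero [simp]: "0 < s \<Longrightarrow> s < pi / 2 \<Longrightarrow> sqrt_tan s \<noteq> 0"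
  using sqrt_tan_pos[of s] by linarith

lemma sqrt_tan_square: "0 < s \<Longrightarrow> s < pi / 2 \<Longrightarrow> (sqrt_tan s)\<^sup>2 = tan s"
  using tan_gt_zero[of s] by (simp add: sqrt_tan_def)

lemma sqrt_tan_mono: "0 < s \<Longrightarrow> s \<le> t \<Longrightarrow> t < pi / 2 \<Longrightarrow> sqrt_tan s \<le> sqrt_tan t"
  by (simp add: sqrt_tan_def tan_mono_le)

lemma sqrt_tan_eq_iff:
  assumes "0 < s" "s < pi / 2" "0 < t" "t < pi / 2"
  shows "sqrt_tan s = sqrt_tan t \<longleftrightarrow> s = t"
  using assms tan_monotone[of s t] tan_monotone[of t s]
  by (cases s t rule: linorder_cases) (auto simp: sqrt_tan_def)

lemma sqrt_tan_has_derivative: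
  assumes "0 < s" "s < pi / 2"
  shows "(sqrt_tan has_real_derivative (1 + (tan s)\<^sup>2) / sqrt_tan s / 2) (at s)"
proof -
  have "cos s \<noteq> 0" using cos_gt_zero[of s] assms by simp
  moreover have "tan s > 0" using assms by (simp add: tan_gt_zero)
  ultimately show ?thesis
    unfolding sqrt_tan_def
    by (auto intro!: derivative_eq_intros simp: tan_sec field_simps)
qed

lemma borel_measurable_sqrt_tan [measurable]: "sqrt_tan \<in> borel_measurable borel"
  unfolding sqrt_tan_def tan_def by measurable

section \<open>The logarithmic kernel in the variable tan s\<close>

lemma borel_measurable_K [measurable (raw)]:
  assumes "f \<in> borel_measurable M" "g \<in> borel_measurable M"
  shows "(\<lambda>x. K (f x) (g x)) \<in> borel_measurable M"
  unfolding K_def using assms by measurable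

lemma K_commute: "K s t = K t s"
proof -
  have "sin (s - t) = - sin (t - s)" by (metis minus_diff_eq sin_minus)
  then show ?thesis by (simp add: K_def add.commute)
qed

text \<open>Both sines in K contain the factor cos s cos t, which cancels and leaves a function of
  tan s / tan t alone. On the diagonal the two sides agree because each is the logarithm of a
  quotient by zero.\<close>

lemma K_eq_ln:
  assumes "0 < s" "s < pi / 2" "0 < t" "t < pi / 2"
  shows "K s t = ln ((1 + (sqrt_tan s / sqrt_tan t)\<^sup>2) / \<bar>1 - (sqrt_tan s / sqrt_tan t)\<^sup>2\<bar>)"
proof -
  have c: "cos s > 0" "cos t > 0" and sn: "sin s > 0" "sin t > 0"
    using assms by (auto intro: cos_gt_zero sin_gt_zero)
  have tn: "tan s > 0" "tan t > 0" using assms by (auto intro: tan_gt_zero)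
  have 1: "sin (s + t) = (tan s + tan t) * (cos s * cos t)"
    using c by (simp add: sin_add tan_def field_simps)
  have 2: "sin (s - t) = (tan s - tan t) * (cos s * cos t)"
    using c by (simp add: sin_diff tan_def field_simps)
  have "\<bar>sin (s + t) / sin (s - t)\<bar> = (tan s + tan t) / \<bar>tan s - tan t\<bar>"
    unfolding 1 2 using c tn by (simp add: abs_mult)
  also have "\<dots> = (1 + tan s / tan t) / \<bar>1 - tan s / tan t\<bar>"
  proof -
    have "1 + tan s / tan t = (tan s + tan t) / tan t" "1 - tan s / tan t = - (tan s - tan t) / tan t"
      using tn by (auto simp: field_simps)
    then show ?thesis using tn by simp
  qed
  finally show ?thesis
    using assms by (simp add: K_def power_divide sqrt_tan_square)
qed

lemma K_nonneg:
  assumes "0 < s" "s < pi / 2" "0 < t" "t < pi / 2"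
  shows "0 \<le> K s t"
  unfolding K_eq_ln[OF assms] by (rule log_ratio_nonneg) (use assms in simp)

text \<open>The factor 1 + tan^2 is the Jacobian of x = tan s, so this is an integral against dx /
  sqrt(x) over the half-line. In terms of u = \<open>sqrt_tan s / sqrt_tan t\<close> that measure is
  2 \<open>sqrt_tan t\<close> du, and \<open>log_primitive\<close> stays between 0 and pi.\<close>

lemma nn_integral_K_weight:
  assumes t: "0 < t" "t < pi / 2"
  shows "(\<integral>\<^sup>+s. ennreal (K s t * (1 + (tan s)\<^sup>2) / sqrt_tan s) \<partial>I0) \<le> ennreal (2 * pi * sqrt_tan t)"
proof -
  let ?G = "\<lambda>s. 2 * sqrt_tan t * log_primitive (sqrt_tan s / sqrt_tan t)"
  have "(\<integral>\<^sup>+s. ennreal (K s t * (1 + (tan s)\<^sup>2) / sqrt_tan s) * indicator {0<..<pi/2} s \<partial>lebesgue)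
      \<le> ennreal (2 * pi * sqrt_tan t - 0)"
  proof (rule nn_integral_le_of_bounded_antiderivative[where S = "{t}" and G = ?G])
    fix s assume s: "s \<in> {0<..<pi/2} - {t}"
    have "(log_primitive has_real_derivative K s t) (at (sqrt_tan s / sqrt_tan t))"
      using s t K_eq_ln[of s t] by (auto intro!: log_primitive_has_derivative simp: sqrt_tan_eq_iff)
    then have "((\<lambda>s. log_primitive (sqrt_tan s / sqrt_tan t)) has_real_derivative
        K s t * (((1 + (tan s)\<^sup>2) / sqrt_tan s / 2) / sqrt_tan t)) (at s)"
      by (rule DERIV_chain2) (rule DERIV_cdivide, rule sqrt_tan_has_derivative, use s in auto)
    then have "(?G has_real_derivative
        2 * sqrt_tan t * (K s t * (((1 + (tan s)\<^sup>2) / sqrt_tan s / 2) / sqrt_tan t))) (at s)"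
      by (rule DERIV_cmult)
    moreover have "2 * sqrt_tan t * (K s t * (((1 + (tan s)\<^sup>2) / sqrt_tan s / 2) / sqrt_tan t))
        = K s t * (1 + (tan s)\<^sup>2) / sqrt_tan s"
      using s t sqrt_tan_pos[of s] sqrt_tan_pos[of t] by (simp add: field_simps)
    ultimately show "(?G has_real_derivative K s t * (1 + (tan s)\<^sup>2) / sqrt_tan s) (at s)"
      by simp
  next
    show "continuous_on {0<..<pi/2} ?G"
      using t
      by (intro continuous_intros continuous_on_compose2[OF continuous_on_log_primitive]
            DERIV_continuous_on[OF DERIV_subset[OF sqrt_tan_has_derivative]])
         (auto simp: less_imp_le)
  next
    show "(\<lambda>s. K s t * (1 + (tan s)\<^sup>2) / sqrt_tan s) \<in> borel_measurable borel"
      unfolding tan_def by measurable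
  next
    fix s assume s: "s \<in> {0<..<pi/2}"
    then show "0 \<le> K s t * (1 + (tan s)\<^sup>2) / sqrt_tan s"
      using t sqrt_tan_pos[of s] by (auto intro!: divide_nonneg_pos mult_nonneg_nonneg K_nonneg)
    have "0 \<le> sqrt_tan s / sqrt_tan t" using s t by (simp add: less_imp_le)
    from log_primitive_bounds[OF this] show "0 \<le> ?G s \<and> ?G s \<le> 2 * pi * sqrt_tan t"
      using t sqrt_tan_pos[of t] by (auto simp: mult_ac less_imp_le)
  qed (use t in \<open>auto simp: less_imp_le\<close>)
  then show ?thesis by (simp add: nn_integral_restrict_space)
qed

text \<open>Here the other variable is integrated. The power 3 comes from the weight y^(-1/2) times
  the factor cot t = 1/y of the Schur kernel. With u = sqrt(x/y) one has y^(-3/2) dy = -2 / sqrt(x)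
  du, hence the negative sign in the primitive.\<close>

lemma nn_integral_K_dual_weight:
  assumes s: "0 < s" "s < pi / 2"
  shows "(\<integral>\<^sup>+t. ennreal (K s t * (1 + (tan t)\<^sup>2) / (sqrt_tan t) ^ 3) \<partial>I0) \<le> ennreal (2 * pi / sqrt_tan s)"
proof -
  let ?G = "\<lambda>t. - 2 / sqrt_tan s * log_primitive (sqrt_tan s / sqrt_tan t)"
  have "(\<integral>\<^sup>+t. ennreal (K s t * (1 + (tan t)\<^sup>2) / (sqrt_tan t) ^ 3) * indicator {0<..<pi/2} t \<partial>lebesgue)
      \<le> ennreal (0 - (- (2 * pi / sqrt_tan s)))"
  proof (rule nn_integral_le_of_bounded_antiderivative[where S = "{s}" and G = ?G])
    fix t assume t: "t \<in> {0<..<pi/2} - {s}"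
    have "(log_primitive has_real_derivative K s t) (at (sqrt_tan s / sqrt_tan t))"
      using s t K_eq_ln[of s t] by (auto intro!: log_primitive_has_derivative simp: sqrt_tan_eq_iff)
    moreover have "((\<lambda>t. sqrt_tan s / sqrt_tan t) has_real_derivative
         - (sqrt_tan s * ((1 + (tan t)\<^sup>2) / sqrt_tan t / 2)) / (sqrt_tan t * sqrt_tan t)) (at t)"
      using t by (auto intro!: derivative_eq_intros sqrt_tan_has_derivative)
    ultimately have "((\<lambda>t. log_primitive (sqrt_tan s / sqrt_tan t)) has_real_derivative
        K s t * (- (sqrt_tan s * ((1 + (tan t)\<^sup>2) / sqrt_tan t / 2)) / (sqrt_tan t * sqrt_tan t))) (at t)"
      by (rule DERIV_chain2)
    then have "(?G has_real_derivative - 2 / sqrt_tan s *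
        (K s t * (- (sqrt_tan s * ((1 + (tan t)\<^sup>2) / sqrt_tan t / 2)) / (sqrt_tan t * sqrt_tan t)))) (at t)"
      by (rule DERIV_cmult)
    moreover have "- 2 / sqrt_tan s *
        (K s t * (- (sqrt_tan s * ((1 + (tan t)\<^sup>2) / sqrt_tan t / 2)) / (sqrt_tan t * sqrt_tan t)))
        = K s t * (1 + (tan t)\<^sup>2) / (sqrt_tan t) ^ 3"
      using s t sqrt_tan_pos[of s] sqrt_tan_pos[of t] by (simp add: power3_eq_cube)
    ultimately show "(?G has_real_derivative K s t * (1 + (tan t)\<^sup>2) / (sqrt_tan t) ^ 3) (at t)"
      by simp
  next
    show "continuous_on {0<..<pi/2} ?G"
      using s sqrt_tan_pos
      by (intro continuous_intros continuous_on_compose2[OF continuous_on_log_primitive]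
            DERIV_continuous_on[OF DERIV_subset[OF sqrt_tan_has_derivative]])
         (auto simp: less_imp_le dest: less_imp_neq[OF sqrt_tan_pos])
  next
    show "(\<lambda>t. K s t * (1 + (tan t)\<^sup>2) / (sqrt_tan t) ^ 3) \<in> borel_measurable borel"
      unfolding tan_def by measurable
  next
    fix t assume t: "t \<in> {0<..<pi/2}"
    then show "0 \<le> K s t * (1 + (tan t)\<^sup>2) / (sqrt_tan t) ^ 3"
      using s sqrt_tan_pos[of t] by (auto intro!: divide_nonneg_pos mult_nonneg_nonneg K_nonneg)
    have "0 \<le> sqrt_tan s / sqrt_tan t" using s t by (simp add: less_imp_le)
    from log_primitive_bounds[OF this] show "- (2 * pi / sqrt_tan s) \<le> ?G t \<and> ?G t \<le> 0"
      using s sqrt_tan_pos[of s] by (auto simp: divide_simps)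
  qed (use s in \<open>auto simp: less_imp_le\<close>)
  then show ?thesis by (simp add: nn_integral_restrict_space)
qed

text \<open>The first and third bounds discard the Jacobian, which is at least 1. The second instead
  uses that the Jacobian dominates tan s, so that x^(-1/2) is at most x^(-3/2) times the Jacobian,
  and then applies the dual integral with the symmetry of K. It supplies decay as t approaches pi/2,
  which the first bound lacks.\<close>

lemma nn_integral_K_le:
  assumes t: "0 < t" "t < pi / 2"
  shows "(\<integral>\<^sup>+s. ennreal (K s t / sqrt_tan s) \<partial>I0) \<le> ennreal (2 * pi * sqrt_tan t)"
    and "(\<integral>\<^sup>+s. ennreal (K s t / sqrt_tan s) \<partial>I0) \<le> ennreal (2 * pi / sqrt_tan t)"
    and "(\<integral>\<^sup>+s. ennreal (K t s / (sqrt_tan s) ^ 3) \<partial>I0) \<le> ennreal (2 * pi / sqrt_tan t)"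
proof -
  have pos: "0 < sqrt_tan s" "0 \<le> K s t" "K t s = K s t" "0 < tan s" "tan s = (sqrt_tan s)\<^sup>2" if "s \<in> space I0" for s
    using that t by (auto simp: K_nonneg K_commute sqrt_tan_square tan_gt_zero)
  have "(\<integral>\<^sup>+s. ennreal (K s t / sqrt_tan s) \<partial>I0)
      \<le> (\<integral>\<^sup>+s. ennreal (K s t * (1 + (tan s)\<^sup>2) / sqrt_tan s) \<partial>I0)"
    using pos by (intro nn_integral_mono ennreal_leI divide_right_mono) (auto simp: algebra_simps less_imp_le)
  also note nn_integral_K_weight[OF t]
  finally show "(\<integral>\<^sup>+s. ennreal (K s t / sqrt_tan s) \<partial>I0) \<le> ennreal (2 * pi * sqrt_tan t)" .
  have "(\<integral>\<^sup>+s. ennreal (K t s / (sqrt_tan s) ^ 3) \<partial>I0)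
      \<le> (\<integral>\<^sup>+s. ennreal (K t s * (1 + (tan s)\<^sup>2) / (sqrt_tan s) ^ 3) \<partial>I0)"
    using pos by (intro nn_integral_mono ennreal_leI divide_right_mono) (auto simp: algebra_simps less_imp_le)
  also note nn_integral_K_dual_weight[OF t]
  finally show "(\<integral>\<^sup>+s. ennreal (K t s / (sqrt_tan s) ^ 3) \<partial>I0) \<le> ennreal (2 * pi / sqrt_tan t)" .
  have "(\<integral>\<^sup>+s. ennreal (K s t / sqrt_tan s) \<partial>I0)
      \<le> (\<integral>\<^sup>+s. ennreal (K t s * (1 + (tan s)\<^sup>2) / (sqrt_tan s) ^ 3) \<partial>I0)"
  proof (intro nn_integral_mono ennreal_leI)
    fix s assume s: "s \<in> space I0"
    have "2 * tan s * 1 \<le> (tan s)\<^sup>2 + 1\<^sup>2" by (rule sum_squares_bound)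
    then have "(sqrt_tan s)\<^sup>2 \<le> 1 + (tan s)\<^sup>2" using pos(4)[OF s] unfolding pos(5)[OF s, symmetric] by simp
    then have "K s t * (sqrt_tan s)\<^sup>2 / (sqrt_tan s) ^ 3 \<le> K s t * (1 + (tan s)\<^sup>2) / (sqrt_tan s) ^ 3"
      using pos[OF s] by (intro divide_right_mono mult_left_mono) auto
    then show "K s t / sqrt_tan s \<le> K t s * (1 + (tan s)\<^sup>2) / (sqrt_tan s) ^ 3"
      using pos[OF s] by (simp add: power3_eq_cube power2_eq_square)
  qed
  also note nn_integral_K_dual_weight[OF t]
  finally show "(\<integral>\<^sup>+s. ennreal (K s t / sqrt_tan s) \<partial>I0) \<le> ennreal (2 * pi / sqrt_tan t)" .
qed

text \<open>Linearising the integral in the exponent produces, after the factor cot t, Hardy's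
  averaging operator in the variable tan. This is the integral of x^(-1/2) from 0 to y; the matching
  column estimate below is the integral of y^(-3/2) from x to infinity.\<close>

lemma nn_integral_Hardy_weight:
  assumes t: "0 < t" "t < pi / 2"
  shows "(\<integral>\<^sup>+s. ennreal (indicator {..t} s / sqrt_tan s) \<partial>I0) \<le> ennreal (2 * sqrt_tan t)"
proof -
  have "(\<integral>\<^sup>+s. ennreal ((1 + (tan s)\<^sup>2) / sqrt_tan s) * indicator {0<..<t} s \<partial>lebesgue) \<le> ennreal (2 * sqrt_tan t - 0)"
  proof (rule nn_integral_le_of_bounded_antiderivative[where S = "{}" and G = "\<lambda>s. 2 * sqrt_tan s"])
    fix s assume "s \<in> {0<..<t} - {}"
    then show "((\<lambda>s. 2 * sqrt_tan s) has_real_derivative (1 + (tan s)\<^sup>2) / sqrt_tan s) (at s)"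
      using t by (intro DERIV_cong[OF DERIV_cmult[OF sqrt_tan_has_derivative]])
        (auto simp: field_simps)
  next
    show "continuous_on {0<..<t} (\<lambda>s. 2 * sqrt_tan s)"
      using t by (intro continuous_intros DERIV_continuous_on[OF DERIV_subset[OF sqrt_tan_has_derivative]]) auto
  next
    show "(\<lambda>s. (1 + (tan s)\<^sup>2) / sqrt_tan s) \<in> borel_measurable borel"
      unfolding tan_def by measurable
  next
    fix s assume "s \<in> {0<..<t}"
    then show "0 \<le> 2 * sqrt_tan s \<and> 2 * sqrt_tan s \<le> 2 * sqrt_tan t" "0 \<le> (1 + (tan s)\<^sup>2) / sqrt_tan s"
      using t sqrt_tan_pos[of s] by (auto intro!: sqrt_tan_mono divide_nonneg_pos simp: less_imp_le)
  qed (use t in \<open>auto simp: less_imp_le\<close>)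
  moreover have "(\<integral>\<^sup>+s. ennreal (indicator {..t} s / sqrt_tan s) \<partial>I0)
      \<le> (\<integral>\<^sup>+s. ennreal ((1 + (tan s)\<^sup>2) / sqrt_tan s) * indicator {0<..<t} s \<partial>lebesgue)"
  proof -
    have "AE s in lebesgue. s \<noteq> t" by (rule AE_completion) (rule AE_lborel_singleton)
    then have "AE s in lebesgue. ennreal (indicator {..t} s / sqrt_tan s) * indicator {0<..<pi/2} s
        \<le> ennreal ((1 + (tan s)\<^sup>2) / sqrt_tan s) * indicator {0<..<t} s"
      by eventually_elim
         (use t in \<open>auto simp: indicator_def less_imp_le intro!: ennreal_leI divide_right_mono\<close>)
    then show ?thesis
      by (subst nn_integral_restrict_space) (auto intro!: nn_integral_mono_AE)
  qed
  ultimately show ?thesis by simp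
qed

lemma nn_integral_Hardy_dual_weight:
  assumes s: "0 < s" "s < pi / 2"
  shows "(\<integral>\<^sup>+t. ennreal (indicator {..t} s / (sqrt_tan t) ^ 3) \<partial>I0) \<le> ennreal (2 / sqrt_tan s)"
proof -
  have "(\<integral>\<^sup>+t. ennreal ((1 + (tan t)\<^sup>2) / (sqrt_tan t) ^ 3) * indicator {s<..<pi/2} t \<partial>lebesgue)
      \<le> ennreal (0 - (- (2 / sqrt_tan s)))"
  proof (rule nn_integral_le_of_bounded_antiderivative[where S = "{}" and G = "\<lambda>t. - 2 / sqrt_tan t"])
    fix t assume t: "t \<in> {s<..<pi/2} - {}"
    then show "((\<lambda>t. - 2 / sqrt_tan t) has_real_derivative (1 + (tan t)\<^sup>2) / (sqrt_tan t) ^ 3) (at t)"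
      using s by (auto intro!: derivative_eq_intros sqrt_tan_has_derivative simp: power3_eq_cube field_simps)
  next
    show "continuous_on {s<..<pi/2} (\<lambda>t. - 2 / sqrt_tan t)"
      using s by (intro continuous_intros DERIV_continuous_on[OF DERIV_subset[OF sqrt_tan_has_derivative]])
        (auto dest: less_trans less_imp_neq[OF sqrt_tan_pos])
  next
    show "(\<lambda>t. (1 + (tan t)\<^sup>2) / (sqrt_tan t) ^ 3) \<in> borel_measurable borel"
      unfolding tan_def by measurable
  next
    fix t assume "t \<in> {s<..<pi/2}"
    then show "- (2 / sqrt_tan s) \<le> - 2 / sqrt_tan t \<and> - 2 / sqrt_tan t \<le> 0" "0 \<le> (1 + (tan t)\<^sup>2) / (sqrt_tan t) ^ 3"
      using s sqrt_tan_pos[of t] sqrt_tan_pos[of s] sqrt_tan_mono[of s t]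
      by (auto intro!: divide_nonneg_pos simp: frac_le less_imp_le)
  qed (use s in \<open>auto simp: less_imp_le\<close>)
  moreover have "(\<integral>\<^sup>+t. ennreal (indicator {..t} s / (sqrt_tan t) ^ 3) \<partial>I0)
      \<le> (\<integral>\<^sup>+t. ennreal ((1 + (tan t)\<^sup>2) / (sqrt_tan t) ^ 3) * indicator {s<..<pi/2} t \<partial>lebesgue)"
  proof -
    have "AE t in lebesgue. t \<noteq> s" by (rule AE_completion) (rule AE_lborel_singleton)
    then have "AE t in lebesgue. ennreal (indicator {..t} s / (sqrt_tan t) ^ 3) * indicator {0<..<pi/2} t
        \<le> ennreal ((1 + (tan t)\<^sup>2) / (sqrt_tan t) ^ 3) * indicator {s<..<pi/2} t"
      by eventually_elim
         (use s in \<open>auto simp: indicator_def less_imp_le intro!: ennreal_leI divide_right_mono\<close>)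
    then show ?thesis
      by (subst nn_integral_restrict_space) (auto intro!: nn_integral_mono_AE)
  qed
  ultimately show ?thesis by simp
qed

section \<open>The Schur test\<close>

text \<open>The inequality 2 A B <= A^2 + B^2 with A = f x * p y and B = f y * p x, multiplied by a
  x * a y / (p x * p y) and integrated over both variables, is twice the claim. Arguing with the
  double integral avoids normalising, hence any separate treatment of zero or infinite
  integrals.\<close>

lemma nn_integral_weighted_Cauchy_Schwarz:
  fixes a f p :: "'a \<Rightarrow> real"
  assumes [measurable]: "a \<in> borel_measurable M" "f \<in> borel_measurable M" "p \<in> borel_measurable M"
    and a: "\<And>x. x \<in> space M \<Longrightarrow> 0 \<le> a x" and f: "\<And>x. x \<in> space M \<Longrightarrow> 0 \<le> f x"
    and p: "\<And>x. x \<in> space M \<Longrightarrow> 0 < p x"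
  shows "(\<integral>\<^sup>+x. ennreal (a x * f x) \<partial>M)\<^sup>2
      \<le> (\<integral>\<^sup>+x. ennreal (a x * p x) \<partial>M) * (\<integral>\<^sup>+x. ennreal (a x * (f x)\<^sup>2 / p x) \<partial>M)"
proof -
  define u v w where "u x = ennreal (a x * f x)" and "v x = ennreal (a x * p x)"
    and "w x = ennreal (a x * (f x)\<^sup>2 / p x)" for x
  have [measurable]: "u \<in> borel_measurable M" "v \<in> borel_measurable M" "w \<in> borel_measurable M"
    unfolding u_def v_def w_def by measurable
  have le: "2 * (u x * u y) \<le> v x * w y + w x * v y" if "x \<in> space M" "y \<in> space M" for x y
  proof -
    have "2 * (f x * p y) * (f y * p x) \<le> (f x * p y)\<^sup>2 + (f y * p x)\<^sup>2"
      by (rule sum_squares_bound)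
    then have "a x * a y * (2 * (f x * p y) * (f y * p x)) \<le> a x * a y * ((f x * p y)\<^sup>2 + (f y * p x)\<^sup>2)"
      using a that by (intro mult_left_mono) auto
    then have "2 * ((a x * f x) * (a y * f y))
        \<le> (a x * p x) * (a y * (f y)\<^sup>2 / p y) + (a x * (f x)\<^sup>2 / p x) * (a y * p y)"
      using p[OF that(1)] p[OF that(2)] by (simp add: field_simps power2_eq_square)
    then have "ennreal (2 * ((a x * f x) * (a y * f y)))
        \<le> ennreal ((a x * p x) * (a y * (f y)\<^sup>2 / p y) + (a x * (f x)\<^sup>2 / p x) * (a y * p y))"
      by (rule ennreal_leI)
    moreover have "0 \<le> a x" "0 \<le> a y" "0 \<le> f x" "0 \<le> f y" "0 < p x" "0 < p y"
      using a f p that by auto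
    ultimately show ?thesis
      by (simp add: u_def v_def w_def ennreal_mult[symmetric] ennreal_plus[symmetric]
            ennreal_numeral[symmetric] del: ennreal_numeral ennreal_plus)
  qed
  have "2 * (integral\<^sup>N M u)\<^sup>2 = (\<integral>\<^sup>+x. (\<integral>\<^sup>+y. 2 * (u x * u y) \<partial>M) \<partial>M)"
    by (simp add: nn_integral_cmult nn_integral_multc power2_eq_square)
  also have "\<dots> \<le> (\<integral>\<^sup>+x. (\<integral>\<^sup>+y. v x * w y + w x * v y \<partial>M) \<partial>M)"
    by (intro nn_integral_mono le)
  also have "\<dots> = integral\<^sup>N M v * integral\<^sup>N M w + integral\<^sup>N M w * integral\<^sup>N M v"
    by (simp add: nn_integral_add nn_integral_cmult nn_integral_multc)
  also have "\<dots> = 2 * (integral\<^sup>N M v * integral\<^sup>N M w)"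
    by (simp only: mult_2 mult.commute[of "integral\<^sup>N M w"])
  finally have "(integral\<^sup>N M u)\<^sup>2 \<le> integral\<^sup>N M v * integral\<^sup>N M w"
    by (simp add: ennreal_mult_le_mult_iff)
  then show ?thesis unfolding u_def[abs_def] v_def[abs_def] w_def[abs_def] .
qed

text \<open>Write k f as the product of sqrt(k p) and sqrt(k f^2 / p). After Cauchy-Schwarz the row
  condition bounds the first factor; exchanging the integrals lets the column condition bound the
  second. Each contributes one factor C.\<close>

lemma Schur_test:
  fixes k :: "'a \<Rightarrow> 'a \<Rightarrow> real" and f p :: "'a \<Rightarrow> real"
  assumes "sigma_finite_measure M"
    and k_meas: "(\<lambda>(x, y). k x y) \<in> borel_measurable (M \<Otimes>\<^sub>M M)"
    and [measurable]: "f \<in> borel_measurable M" "p \<in> borel_measurable M"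
    and k: "\<And>x y. x \<in> space M \<Longrightarrow> y \<in> space M \<Longrightarrow> 0 \<le> k x y"
    and f: "\<And>x. x \<in> space M \<Longrightarrow> 0 \<le> f x"
    and p: "\<And>x. x \<in> space M \<Longrightarrow> 0 < p x"
    and C: "0 \<le> C"
    and row: "\<And>x. x \<in> space M \<Longrightarrow> (\<integral>\<^sup>+y. ennreal (k x y * p y) \<partial>M) \<le> ennreal (C * p x)"
    and col: "\<And>y. y \<in> space M \<Longrightarrow> (\<integral>\<^sup>+x. ennreal (k x y * p x) \<partial>M) \<le> ennreal (C * p y)"
  shows "(\<integral>\<^sup>+x. (\<integral>\<^sup>+y. ennreal (k x y * f y) \<partial>M)\<^sup>2 \<partial>M) \<le> ennreal (C\<^sup>2) * (\<integral>\<^sup>+x. ennreal ((f x)\<^sup>2) \<partial>M)"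
proof -
  interpret sigma_finite_measure M by fact
  interpret P: pair_sigma_finite M M ..
  note [measurable] = k_meas
  have "(\<integral>\<^sup>+x. (\<integral>\<^sup>+y. ennreal (k x y * f y) \<partial>M)\<^sup>2 \<partial>M)
      \<le> (\<integral>\<^sup>+x. (\<integral>\<^sup>+y. ennreal C * ennreal (p x * (k x y * (f y)\<^sup>2 / p y)) \<partial>M) \<partial>M)"
  proof (rule nn_integral_mono)
    fix x assume x: "x \<in> space M"
    have [measurable]: "k x \<in> borel_measurable M" using x by measurable
    have "(\<integral>\<^sup>+y. ennreal (k x y * f y) \<partial>M)\<^sup>2
        \<le> (\<integral>\<^sup>+y. ennreal (k x y * p y) \<partial>M) * (\<integral>\<^sup>+y. ennreal (k x y * (f y)\<^sup>2 / p y) \<partial>M)"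
      by (rule nn_integral_weighted_Cauchy_Schwarz) (use x k f p in auto)
    also have "\<dots> \<le> ennreal (C * p x) * (\<integral>\<^sup>+y. ennreal (k x y * (f y)\<^sup>2 / p y) \<partial>M)"
      by (intro mult_right_mono row x) simp
    also have "\<dots> = (\<integral>\<^sup>+y. ennreal (C * p x) * ennreal (k x y * (f y)\<^sup>2 / p y) \<partial>M)"
      by (rule nn_integral_cmult[symmetric]) measurable
    also have "\<dots> = (\<integral>\<^sup>+y. ennreal C * ennreal (p x * (k x y * (f y)\<^sup>2 / p y)) \<partial>M)"
      using x k p C
      by (intro nn_integral_cong) (simp add: ennreal_mult'[symmetric] mult.assoc less_imp_le)
    finally show "(\<integral>\<^sup>+y. ennreal (k x y * f y) \<partial>M)\<^sup>2
        \<le> (\<integral>\<^sup>+y. ennreal C * ennreal (p x * (k x y * (f y)\<^sup>2 / p y)) \<partial>M)" .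
  qed
  also have "\<dots> = (\<integral>\<^sup>+y. (\<integral>\<^sup>+x. ennreal C * ennreal (p x * (k x y * (f y)\<^sup>2 / p y)) \<partial>M) \<partial>M)"
    by (rule P.Fubini'[symmetric]) measurable
  also have "\<dots> \<le> (\<integral>\<^sup>+y. ennreal (C\<^sup>2) * ennreal ((f y)\<^sup>2) \<partial>M)"
  proof (rule nn_integral_mono)
    fix y assume y: "y \<in> space M"
    have [measurable]: "(\<lambda>x. k x y) \<in> borel_measurable M" using y by measurable
    have "(\<integral>\<^sup>+x. ennreal C * ennreal (p x * (k x y * (f y)\<^sup>2 / p y)) \<partial>M)
        = (\<integral>\<^sup>+x. ennreal (C * (f y)\<^sup>2 / p y) * ennreal (k x y * p x) \<partial>M)"
      using C p[OF y]
      by (intro nn_integral_cong, subst (1 2) ennreal_mult'[symmetric]) (auto simp: mult_ac)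
    also have "\<dots> = ennreal (C * (f y)\<^sup>2 / p y) * (\<integral>\<^sup>+x. ennreal (k x y * p x) \<partial>M)"
      by (rule nn_integral_cmult) measurable
    also have "\<dots> \<le> ennreal (C * (f y)\<^sup>2 / p y) * ennreal (C * p y)"
      by (intro mult_left_mono col y) simp
    also have "\<dots> = ennreal (C\<^sup>2) * ennreal ((f y)\<^sup>2)"
      using C p[OF y] by (simp add: ennreal_mult'[symmetric] power2_eq_square mult_ac)
    finally show "(\<integral>\<^sup>+x. ennreal C * ennreal (p x * (k x y * (f y)\<^sup>2 / p y)) \<partial>M)
        \<le> ennreal (C\<^sup>2) * ennreal ((f y)\<^sup>2)" .
  qed
  also have "\<dots> = ennreal (C\<^sup>2) * (\<integral>\<^sup>+x. ennreal ((f x)\<^sup>2) \<partial>M)"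
    by (rule nn_integral_cmult) measurable
  finally show ?thesis .
qed

section \<open>Schur bounds for the kernels on (0, pi/2)\<close>

lemma sigma_finite_I0: "sigma_finite_measure I0"
proof -
  interpret finite_measure I0 by (rule finite_measure_lebesgue_on) simp
  show ?thesis ..
qed

lemma borel_measurable_I0: "f \<in> borel_measurable borel \<Longrightarrow> f \<in> borel_measurable I0"
  by (simp add: measurable_completion measurable_restrict_space1)

text \<open>\<open>I0\<close> carries the Lebesgue sets, whereas the kernels are given by Borel
  formulas; joint measurability is pulled back along the identity in each coordinate.\<close>

lemma borel_measurable_pair_I0:
  assumes "(\<lambda>(x, y). k x y) \<in> borel_measurable (borel \<Otimes>\<^sub>M borel)"
  shows "(\<lambda>(x, y). k x y) \<in> borel_measurable (I0 \<Otimes>\<^sub>M I0)"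
proof -
  have [measurable]: "(\<lambda>x. x) \<in> measurable I0 borel" by (rule borel_measurable_I0) simp
  have "(\<lambda>z. (fst z, snd z)) \<in> measurable (I0 \<Otimes>\<^sub>M I0) (borel \<Otimes>\<^sub>M borel)"
    by (intro measurable_Pair measurable_compose[OF measurable_fst] measurable_compose[OF measurable_snd]) measurable
  from measurable_compose[OF this assms] show ?thesis by (simp add: case_prod_beta)
qed

text \<open>Dividing by the square is multiplying by cot t. The first argument is the point at which
  \<open>Phi\<close> is evaluated, and 1 / (3 pi) combines the 1/pi in H with the 1/3 in front of
  it.\<close>

definition Phi_kernel :: "real \<Rightarrow> real \<Rightarrow> real" where
  "Phi_kernel t s = (K s t / (3 * pi) + indicator {..t} s) / (sqrt_tan t)\<^sup>2"

lemma Phi_kernel_nonneg: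
  assumes "0 < s" "s < pi / 2" "0 < t" "t < pi / 2"
  shows "0 \<le> Phi_kernel t s"
  using assms by (simp add: Phi_kernel_def K_nonneg)

lemma Phi_kernel_row:
  assumes t: "0 < t" "t < pi / 2"
  shows "(\<integral>\<^sup>+s. ennreal (Phi_kernel t s * (1 / sqrt_tan s)) \<partial>I0) \<le> ennreal (8 / 3 * (1 / sqrt_tan t))"
proof -
  define c where "c = 1 / (3 * pi * (sqrt_tan t)\<^sup>2)"
  define d where "d = 1 / (sqrt_tan t)\<^sup>2"
  have cd: "0 \<le> c" "0 \<le> d" by (auto simp: c_def d_def)
  have [measurable]: "(\<lambda>s. K s t / sqrt_tan s) \<in> borel_measurable I0"
    "(\<lambda>s. indicator {..t} s / sqrt_tan s :: real) \<in> borel_measurable I0"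
    by (rule borel_measurable_I0, measurable)+
  have "(\<integral>\<^sup>+s. ennreal (Phi_kernel t s * (1 / sqrt_tan s)) \<partial>I0)
      = (\<integral>\<^sup>+s. ennreal c * ennreal (K s t / sqrt_tan s) + ennreal d * ennreal (indicator {..t} s / sqrt_tan s) \<partial>I0)"
  proof (rule nn_integral_cong)
    fix s assume s: "s \<in> space I0"
    have eq: "Phi_kernel t s * (1 / sqrt_tan s) = c * (K s t / sqrt_tan s) + d * (indicator {..t} s / sqrt_tan s)"
      by (simp add: Phi_kernel_def c_def d_def add_divide_distrib mult_ac)
    have nn: "0 \<le> K s t / sqrt_tan s" "(0::real) \<le> indicator {..t} s / sqrt_tan s"
      using s t by (auto simp: K_nonneg less_imp_le)
    show "ennreal (Phi_kernel t s * (1 / sqrt_tan s))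
      = ennreal c * ennreal (K s t / sqrt_tan s) + ennreal d * ennreal (indicator {..t} s / sqrt_tan s)"
      unfolding eq using cd nn by (simp only: ennreal_mult ennreal_plus mult_nonneg_nonneg)
  qed
  also have "\<dots> = ennreal c * (\<integral>\<^sup>+s. ennreal (K s t / sqrt_tan s) \<partial>I0)
      + ennreal d * (\<integral>\<^sup>+s. ennreal (indicator {..t} s / sqrt_tan s) \<partial>I0)"
    by (simp add: nn_integral_add nn_integral_cmult)
  also have "\<dots> \<le> ennreal c * ennreal (2 * pi * sqrt_tan t) + ennreal d * ennreal (2 * sqrt_tan t)"
    using t by (intro add_mono mult_left_mono nn_integral_K_le nn_integral_Hardy_weight) auto
  also have "\<dots> = ennreal (c * (2 * pi * sqrt_tan t) + d * (2 * sqrt_tan t))"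
    using t cd by (simp add: ennreal_mult ennreal_plus less_imp_le)
  also have "c * (2 * pi * sqrt_tan t) + d * (2 * sqrt_tan t) = 8 / 3 * (1 / sqrt_tan t)"
    using t by (simp add: c_def d_def field_simps power2_eq_square)
  finally show ?thesis .
qed

lemma Phi_kernel_column:
  assumes s: "0 < s" "s < pi / 2"
  shows "(\<integral>\<^sup>+t. ennreal (Phi_kernel t s * (1 / sqrt_tan t)) \<partial>I0) \<le> ennreal (8 / 3 * (1 / sqrt_tan s))"
proof -
  have [measurable]: "(\<lambda>t. K s t / (sqrt_tan t) ^ 3) \<in> borel_measurable I0"
    "(\<lambda>t. indicator {..t} s / (sqrt_tan t) ^ 3 :: real) \<in> borel_measurable I0"
    by (rule borel_measurable_I0, simp add: indicator_def)+
  have "(\<integral>\<^sup>+t. ennreal (Phi_kernel t s * (1 / sqrt_tan t)) \<partial>I0)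
      = (\<integral>\<^sup>+t. ennreal (1 / (3 * pi)) * ennreal (K s t / (sqrt_tan t) ^ 3) + ennreal (indicator {..t} s / (sqrt_tan t) ^ 3) \<partial>I0)"
  proof (rule nn_integral_cong)
    fix t assume t: "t \<in> space I0"
    have eq: "Phi_kernel t s * (1 / sqrt_tan t) = 1 / (3 * pi) * (K s t / (sqrt_tan t) ^ 3) + indicator {..t} s / (sqrt_tan t) ^ 3"
      by (simp add: Phi_kernel_def add_divide_distrib mult_ac power2_eq_square power3_eq_cube)
    have nn: "0 \<le> K s t / (sqrt_tan t) ^ 3" "(0::real) \<le> indicator {..t} s / (sqrt_tan t) ^ 3"
      using s t by (auto simp: K_nonneg less_imp_le)
    show "ennreal (Phi_kernel t s * (1 / sqrt_tan t))
      = ennreal (1 / (3 * pi)) * ennreal (K s t / (sqrt_tan t) ^ 3) + ennreal (indicator {..t} s / (sqrt_tan t) ^ 3)"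
    proof -
      have "0 \<le> 1 / (3 * pi)" by simp
      then show ?thesis
        unfolding eq using nn by (simp only: ennreal_mult ennreal_plus mult_nonneg_nonneg)
    qed
  qed
  also have "\<dots> = ennreal (1 / (3 * pi)) * (\<integral>\<^sup>+t. ennreal (K s t / (sqrt_tan t) ^ 3) \<partial>I0)
      + (\<integral>\<^sup>+t. ennreal (indicator {..t} s / (sqrt_tan t) ^ 3) \<partial>I0)"
    by (simp add: nn_integral_add nn_integral_cmult)
  also have "\<dots> \<le> ennreal (1 / (3 * pi)) * ennreal (2 * pi / sqrt_tan s) + ennreal (2 / sqrt_tan s)"
    using s by (intro add_mono mult_left_mono nn_integral_K_le nn_integral_Hardy_dual_weight) auto
  also have "\<dots> = ennreal (1 / (3 * pi) * (2 * pi / sqrt_tan s) + 2 / sqrt_tan s)"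
    using s by (simp add: ennreal_mult[symmetric] ennreal_plus[symmetric] less_imp_le del: ennreal_plus)
  also have "1 / (3 * pi) * (2 * pi / sqrt_tan s) + 2 / sqrt_tan s = 8 / 3 * (1 / sqrt_tan s)"
    using s by (simp add: field_simps)
  finally show ?thesis .
qed

lemma Phi_kernel_measurable:
  "(\<lambda>(t, s). Phi_kernel t s) \<in> borel_measurable (I0 \<Otimes>\<^sub>M I0)"
  by (rule borel_measurable_pair_I0) (simp add: Phi_kernel_def indicator_def)

lemma Phi_kernel_L2_bound:
  assumes "f \<in> borel_measurable I0" "\<And>s. s \<in> space I0 \<Longrightarrow> 0 \<le> f s"
  shows "(\<integral>\<^sup>+t. (\<integral>\<^sup>+s. ennreal (Phi_kernel t s * f s) \<partial>I0)\<^sup>2 \<partial>I0) \<le> ennreal ((8/3)\<^sup>2) * (\<integral>\<^sup>+s. ennreal ((f s)\<^sup>2) \<partial>I0)"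
  using assms
  by (intro Schur_test[where p = "\<lambda>s. 1 / sqrt_tan s"] sigma_finite_I0 Phi_kernel_measurable)
     (auto intro!: borel_measurable_I0 Phi_kernel_nonneg Phi_kernel_row[simplified] Phi_kernel_column[simplified])

text \<open>This bounds w -> pi cot t * H w t separately from the full kernel. It is what the
  unit-ball estimate needs, since there the exponential is estimated by 1 and only the logarithmic
  part of the kernel is left.\<close>

lemma K_L2_bound:
  assumes "f \<in> borel_measurable I0" "\<And>s. s \<in> space I0 \<Longrightarrow> 0 \<le> f s"
  shows "(\<integral>\<^sup>+t. (\<integral>\<^sup>+s. ennreal (K s t / (sqrt_tan t)\<^sup>2 * f s) \<partial>I0)\<^sup>2 \<partial>I0) \<le> ennreal ((2 * pi)\<^sup>2) * (\<integral>\<^sup>+s. ennreal ((f s)\<^sup>2) \<partial>I0)"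
proof (rule Schur_test[where p = "\<lambda>s. 1 / sqrt_tan s"])
  show "(\<lambda>(t, s). K s t / (sqrt_tan t)\<^sup>2) \<in> borel_measurable (I0 \<Otimes>\<^sub>M I0)"
    by (rule borel_measurable_pair_I0) simp
  fix t assume t: "t \<in> space I0"
  have [measurable]: "(\<lambda>s. K s t / sqrt_tan s) \<in> borel_measurable I0"
    by (rule borel_measurable_I0) measurable
  have "(\<integral>\<^sup>+s. ennreal (K s t / (sqrt_tan t)\<^sup>2 * (1 / sqrt_tan s)) \<partial>I0)
      = (\<integral>\<^sup>+s. ennreal (1 / (sqrt_tan t)\<^sup>2) * ennreal (K s t / sqrt_tan s) \<partial>I0)"
    by (intro nn_integral_cong, subst ennreal_mult'[symmetric]) (auto simp: mult_ac)
  also have "\<dots> = ennreal (1 / (sqrt_tan t)\<^sup>2) * (\<integral>\<^sup>+s. ennreal (K s t / sqrt_tan s) \<partial>I0)"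
    by (rule nn_integral_cmult) measurable
  also have "\<dots> \<le> ennreal (1 / (sqrt_tan t)\<^sup>2) * ennreal (2 * pi * sqrt_tan t)"
    using t by (intro mult_left_mono nn_integral_K_le) auto
  also have "\<dots> = ennreal (2 * pi * (1 / sqrt_tan t))"
    using t by (simp add: ennreal_mult'[symmetric] power2_eq_square)
  finally show "(\<integral>\<^sup>+s. ennreal (K s t / (sqrt_tan t)\<^sup>2 * (1 / sqrt_tan s)) \<partial>I0) \<le> ennreal (2 * pi * (1 / sqrt_tan t))" .
  show "(\<integral>\<^sup>+s. ennreal (K t s / (sqrt_tan s)\<^sup>2 * (1 / sqrt_tan s)) \<partial>I0) \<le> ennreal (2 * pi * (1 / sqrt_tan t))"
    using nn_integral_K_le(3)[of t] t by (simp add: power2_eq_square power3_eq_cube)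
qed (use assms in \<open>auto intro!: sigma_finite_I0 borel_measurable_I0 K_nonneg divide_nonneg_nonneg\<close>)

section \<open>The Lipschitz estimate\<close>

lemma abs_sin_diff_le: "\<bar>sin x - sin y\<bar> \<le> \<bar>x - y\<bar>" for x y :: real
proof -
  have "\<bar>sin x - sin y\<bar> = 2 * \<bar>sin ((x - y) / 2)\<bar> * \<bar>cos ((x + y) / 2)\<bar>"
    by (simp add: sin_diff_sin abs_mult)
  also have "\<dots> \<le> 2 * \<bar>(x - y) / 2\<bar> * 1"
    by (intro mult_mono abs_sin_x_le_abs_x) auto
  finally show ?thesis by simp
qed

lemma abs_exp_minus_diff_le:
  fixes x y :: real
  assumes "0 \<le> x" "0 \<le> y"
  shows "\<bar>exp (- x) - exp (- y)\<bar> \<le> \<bar>x - y\<bar>"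
proof -
  have *: "exp (- a) - exp (- b) \<le> b - a \<and> exp (- b) \<le> exp (- a)" if "0 \<le> a" "a \<le> b" for a b :: real
  proof -
    have "exp (- a) - exp (- b) = exp (- a) * (1 - exp (- (b - a)))"
      by (simp add: exp_diff exp_minus field_simps)
    also have "\<dots> \<le> 1 * (b - a)"
    proof (rule mult_mono)
      show "1 - exp (- (b - a)) \<le> b - a" using exp_ge_add_one_self[of "- (b - a)"] by linarith
    qed (use that in auto)
    finally show ?thesis using that by simp
  qed
  show ?thesis
    using *[of x y] *[of y x] assms by (cases "x \<le> y") auto
qed

text \<open>Telescope the product: for non-negative exponents both factors, sin and exp of minus the
  exponent, are 1-Lipschitz and at most 1 in absolute value. This is where the sign of the unknown
  functions enters the Lipschitz estimate.\<close>

lemma abs_sin_mult_exp_diff_le: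
  fixes A B E F :: real
  assumes "0 \<le> E" "0 \<le> F"
  shows "\<bar>sin A / exp E - sin B / exp F\<bar> \<le> \<bar>A - B\<bar> + \<bar>E - F\<bar>"
proof -
  have "sin A / exp E - sin B / exp F = (sin A - sin B) * exp (- E) + sin B * (exp (- E) - exp (- F))"
    by (simp add: exp_minus field_simps)
  also have "\<bar>\<dots>\<bar> \<le> \<bar>sin A - sin B\<bar> * exp (- E) + \<bar>sin B\<bar> * \<bar>exp (- E) - exp (- F)\<bar>"
    by (rule order_trans[OF abs_triangle_ineq]) (simp add: abs_mult)
  also have "\<dots> \<le> \<bar>A - B\<bar> * 1 + 1 * \<bar>E - F\<bar>"
    using assms by (intro add_mono mult_mono abs_sin_diff_le abs_exp_minus_diff_le) auto
  finally show ?thesis by simp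
qed

section \<open>Measurability and integrability for \<open>Phi\<close>\<close>

lemma integral_lebesgue_on_eq_I0:
  fixes w :: "real \<Rightarrow> real"
  assumes t: "0 < t" "t < pi / 2" and w: "w \<in> borel_measurable I0"
  shows "(\<integral>s. w s \<partial>lebesgue_on {0..t}) = (\<integral>s. indicator {..t} s * w s \<partial>I0)"
proof -
  have m: "(\<lambda>s. indicator {0<..<pi/2} s *\<^sub>R w s) \<in> borel_measurable lebesgue"
    using w by (subst (asm) borel_measurable_restrict_space_iff) auto
  have ind: "(indicator {..t} :: real \<Rightarrow> real) \<in> borel_measurable lebesgue"
    by (rule measurable_completion) simp
  let ?g = "\<lambda>s. indicator {0<..<pi/2} s *\<^sub>R (indicator {..t} s * w s)"
  have g: "?g \<in> borel_measurable lebesgue"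
    using borel_measurable_times[OF ind m] by (simp add: mult_ac)
  have "(\<integral>s. w s \<partial>lebesgue_on {0..t}) = (\<integral>s. indicator {0..t} s *\<^sub>R w s \<partial>lebesgue)"
    by (rule integral_restrict_space) simp
  also have "\<dots> = (\<integral>s. ?g s \<partial>lebesgue)"
  proof (rule integral_cong_AE)
    have "(indicator {0} :: real \<Rightarrow> real) \<in> borel_measurable lebesgue"
      by (rule measurable_completion) simp
    then have "(\<lambda>s. ?g s + indicator {0} s * w 0) \<in> borel_measurable lebesgue"
      using g by (intro borel_measurable_add borel_measurable_times) auto
    \<comment> \<open>Measurability on \<open>I0\<close> says nothing about w 0, so the endpoint is
      split off as a multiple of the indicator of a point.\<close>
    moreover have "(\<lambda>s. indicator {0..t} s *\<^sub>R w s) = (\<lambda>s. ?g s + indicator {0} s * w 0)"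
      using t by (auto simp: indicator_def fun_eq_iff)
    ultimately show "(\<lambda>s. indicator {0..t} s *\<^sub>R w s) \<in> borel_measurable lebesgue" by simp
    have "AE s in lebesgue. s \<noteq> (0::real)" by (rule AE_completion) (rule AE_lborel_singleton)
    then show "AE s in lebesgue. indicator {0..t} s *\<^sub>R w s = ?g s"
      by eventually_elim (use t in \<open>auto simp: indicator_def\<close>)
  qed (rule g)
  also have "\<dots> = (\<integral>s. indicator {..t} s * w s \<partial>I0)"
    by (rule integral_restrict_space[symmetric]) simp
  finally show ?thesis .
qed

lemma Phi_eq:
  assumes t: "0 < t" "t < pi / 2" and w: "w \<in> borel_measurable I0"
  shows "Phi \<alpha> w t = 3 / (\<alpha> * pi) / (sqrt_tan t)\<^sup>2 *
    (sin (t + H w t / 3) / exp (\<integral>s. indicator {..t} s * w s \<partial>I0))"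
proof -
  have "cot t = 1 / (sqrt_tan t)\<^sup>2"
    using t by (simp add: sqrt_tan_square cot_def tan_def)
  then show ?thesis
    unfolding Phi_def integral_lebesgue_on_eq_I0[OF t w] by (simp add: field_simps)
qed

lemma borel_measurable_H:
  assumes [measurable]: "w \<in> borel_measurable I0"
  shows "H w \<in> borel_measurable I0"
proof -
  interpret sigma_finite_measure I0 by (rule sigma_finite_I0)
  have [measurable]: "(\<lambda>(t, s). K s t) \<in> borel_measurable (I0 \<Otimes>\<^sub>M I0)"
    by (rule borel_measurable_pair_I0) measurable
  have "(\<lambda>(t, s). K s t * w s) \<in> borel_measurable (I0 \<Otimes>\<^sub>M I0)"
    by measurable
  then have "(\<lambda>t. \<integral>s. K s t * w s \<partial>I0) \<in> borel_measurable I0"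
    by (rule borel_measurable_lebesgue_integral)
  then show ?thesis unfolding H_def[abs_def] by measurable
qed

lemma borel_measurable_Phi:
  assumes w [measurable]: "w \<in> borel_measurable I0"
  shows "Phi \<alpha> w \<in> borel_measurable I0"
proof -
  interpret sigma_finite_measure I0 by (rule sigma_finite_I0)
  note [measurable] = borel_measurable_H[OF w]
  have [measurable]: "(\<lambda>(t, s). indicator {..t} s :: real) \<in> borel_measurable (I0 \<Otimes>\<^sub>M I0)"
    by (rule borel_measurable_pair_I0) (simp add: indicator_def)
  have "(\<lambda>(t, s). indicator {..t} s * w s) \<in> borel_measurable (I0 \<Otimes>\<^sub>M I0)"
    by measurable
  then have [measurable]: "(\<lambda>t. \<integral>s. indicator {..t} s * w s \<partial>I0) \<in> borel_measurable I0"
    by (rule borel_measurable_lebesgue_integral)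
  have [measurable]: "sqrt_tan \<in> borel_measurable I0" "(\<lambda>t. t) \<in> borel_measurable I0"
    by (rule borel_measurable_I0, simp)+
  have "(\<lambda>t. 3 / (\<alpha> * pi) / (sqrt_tan t)\<^sup>2 *
    (sin (t + H w t / 3) / exp (\<integral>s. indicator {..t} s * w s \<partial>I0))) \<in> borel_measurable I0"
    by measurable
  then show ?thesis
    by (rule measurable_cong[THEN iffD1, rotated]) (simp add: Phi_eq w)
qed

text \<open>Bochner integrals default to 0 for non-integrable functions. Finiteness of the
  non-negative integral excludes this at the point t, so that the integrals inside
  \<open>Phi\<close> may be subtracted.\<close>

lemma K_integrable:
  assumes t: "0 < t" "t < pi / 2" and w [measurable]: "w \<in> borel_measurable I0"
    and fin: "(\<integral>\<^sup>+s. ennreal (Phi_kernel t s * \<bar>w s\<bar>) \<partial>I0) < \<infinity>"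
  shows "integrable I0 (\<lambda>s. K s t * w s)" "integrable I0 (\<lambda>s. indicator {..t} s * w s)"
proof -
  have [measurable]: "(\<lambda>s. K s t) \<in> borel_measurable I0" "(\<lambda>s. indicator {..t} s :: real) \<in> borel_measurable I0"
    "Phi_kernel t \<in> borel_measurable I0"
    unfolding Phi_kernel_def[abs_def] by (rule borel_measurable_I0, simp)+
  have pos: "0 < (sqrt_tan t)\<^sup>2" using t by simp
  have K0: "0 \<le> K s t" if "s \<in> space I0" for s using that t by (simp add: K_nonneg)
  have int: "integrable I0 (\<lambda>s. c s * w s)"
    if [measurable]: "c \<in> borel_measurable I0"
      and c: "\<And>s. s \<in> space I0 \<Longrightarrow> 0 \<le> c s \<and> c s \<le> (3 * pi * (sqrt_tan t)\<^sup>2) * Phi_kernel t s" for c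
  proof (rule integrableI_bounded)
    have "(\<integral>\<^sup>+s. ennreal (norm (c s * w s)) \<partial>I0)
        \<le> (\<integral>\<^sup>+s. ennreal (3 * pi * (sqrt_tan t)\<^sup>2) * ennreal (Phi_kernel t s * \<bar>w s\<bar>) \<partial>I0)"
    proof (rule nn_integral_mono)
      fix s assume s: "s \<in> space I0"
      have "norm (c s * w s) = c s * \<bar>w s\<bar>" using c[OF s] by (simp add: abs_mult)
      also have "\<dots> \<le> (3 * pi * (sqrt_tan t)\<^sup>2) * Phi_kernel t s * \<bar>w s\<bar>"
        using c[OF s] by (intro mult_right_mono) auto
      finally show "ennreal (norm (c s * w s)) \<le> ennreal (3 * pi * (sqrt_tan t)\<^sup>2) * ennreal (Phi_kernel t s * \<bar>w s\<bar>)"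
        using pos by (subst ennreal_mult'[symmetric]) (auto simp: mult.assoc intro: ennreal_leI)
    qed
    also have "\<dots> = ennreal (3 * pi * (sqrt_tan t)\<^sup>2) * (\<integral>\<^sup>+s. ennreal (Phi_kernel t s * \<bar>w s\<bar>) \<partial>I0)"
      by (rule nn_integral_cmult) measurable
    also have "\<dots> < \<infinity>" using fin by (simp add: ennreal_mult_less_top)
    finally show "(\<integral>\<^sup>+s. ennreal (norm (c s * w s)) \<partial>I0) < \<infinity>" .
  qed measurable
  \<comment> \<open>The factor 3 pi tan t clears the denominators of \<open>Phi_kernel\<close>; the
    resulting sum dominates K as well as the indicator.\<close>
  have eq: "(3 * pi * (sqrt_tan t)\<^sup>2) * Phi_kernel t s = K s t + 3 * pi * indicator {..t} s" for s
    using t by (simp add: Phi_kernel_def field_simps)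
  show "integrable I0 (\<lambda>s. K s t * w s)"
    by (rule int) (use K0 in \<open>auto simp: eq\<close>)
  show "integrable I0 (\<lambda>s. indicator {..t} s * w s)"
  proof (rule int)
    fix s assume "s \<in> space I0"
    from K0[OF this] show "0 \<le> (indicator {..t} s :: real) \<and> indicator {..t} s \<le> 3 * pi * (sqrt_tan t)\<^sup>2 * Phi_kernel t s"
      unfolding eq using pi_gt3 by (auto simp: indicator_def)
  qed simp
qed

text \<open>The estimate is local in t, with finiteness as a hypothesis, so that it serves two
  settings: for L2 functions finiteness holds at almost every t by the Schur test, for functions
  below the weight at every t by the row condition.\<close>

lemma Phi_diff_le:
  assumes \<alpha>: "0 < \<alpha>" and t: "0 < t" "t < pi / 2"
    and v [measurable]: "v \<in> borel_measurable I0" and w [measurable]: "w \<in> borel_measurable I0"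
    and v0: "AE s in I0. 0 \<le> v s" and w0: "AE s in I0. 0 \<le> w s"
    and vfin: "(\<integral>\<^sup>+s. ennreal (Phi_kernel t s * \<bar>v s\<bar>) \<partial>I0) < \<infinity>"
    and wfin: "(\<integral>\<^sup>+s. ennreal (Phi_kernel t s * \<bar>w s\<bar>) \<partial>I0) < \<infinity>"
  shows "ennreal \<bar>Phi \<alpha> v t - Phi \<alpha> w t\<bar>
    \<le> ennreal (3 / (\<alpha> * pi)) * (\<integral>\<^sup>+s. ennreal (Phi_kernel t s * \<bar>v s - w s\<bar>) \<partial>I0)"
proof -
  note vi = K_integrable[OF t v vfin] and wi = K_integrable[OF t w wfin]
  let ?E = "\<lambda>u. \<integral>s. indicator {..t} s * u s \<partial>I0"
  have [measurable]: "Phi_kernel t \<in> borel_measurable I0"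
    unfolding Phi_kernel_def[abs_def] by (rule borel_measurable_I0) simp
  have K0: "0 \<le> K s t" if "s \<in> space I0" for s using that t by (simp add: K_nonneg)
  have Ki: "integrable I0 (\<lambda>s. K s t * \<bar>v s - w s\<bar>)"
    using Bochner_Integration.integrable_abs[OF Bochner_Integration.integrable_diff[OF vi(1) wi(1)]]
    by (rule Bochner_Integration.integrable_cong[THEN iffD1, rotated 2])
       (use K0 in \<open>auto simp: abs_mult right_diff_distrib[symmetric]\<close>)
  have Ii: "integrable I0 (\<lambda>s. indicator {..t} s * \<bar>v s - w s\<bar>)"
    using Bochner_Integration.integrable_abs[OF Bochner_Integration.integrable_diff[OF vi(2) wi(2)]]
    by (rule Bochner_Integration.integrable_cong[THEN iffD1, rotated 2])
       (auto simp: abs_mult right_diff_distrib[symmetric])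
  have dH: "\<bar>H v t - H w t\<bar> \<le> 1 / pi * (\<integral>s. K s t * \<bar>v s - w s\<bar> \<partial>I0)"
  proof -
    have "H v t - H w t = 1 / pi * (\<integral>s. K s t * v s - K s t * w s \<partial>I0)"
      using vi wi by (simp add: H_def right_diff_distrib)
    also have "\<bar>\<dots>\<bar> \<le> 1 / pi * (\<integral>s. \<bar>K s t * v s - K s t * w s\<bar> \<partial>I0)"
      unfolding abs_mult by (intro mult_mono integral_abs_bound) auto
    also have "(\<integral>s. \<bar>K s t * v s - K s t * w s\<bar> \<partial>I0) = (\<integral>s. K s t * \<bar>v s - w s\<bar> \<partial>I0)"
      by (rule Bochner_Integration.integral_cong) (use K0 in \<open>auto simp: abs_mult right_diff_distrib[symmetric]\<close>)
    finally show ?thesis .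
  qed
  have dE: "\<bar>?E v - ?E w\<bar> \<le> (\<integral>s. indicator {..t} s * \<bar>v s - w s\<bar> \<partial>I0)"
  proof -
    have "?E v - ?E w = (\<integral>s. indicator {..t} s * v s - indicator {..t} s * w s \<partial>I0)"
      using vi wi by simp
    also have "\<bar>\<dots>\<bar> \<le> (\<integral>s. \<bar>indicator {..t} s * v s - indicator {..t} s * w s\<bar> \<partial>I0)"
      by (rule integral_abs_bound)
    also have "\<dots> = (\<integral>s. indicator {..t} s * \<bar>v s - w s\<bar> \<partial>I0)"
      by (rule Bochner_Integration.integral_cong) (auto simp: abs_mult right_diff_distrib[symmetric])
    finally show ?thesis .
  qed
  have "0 \<le> ?E u" if "AE s in I0. 0 \<le> u s" for u :: "real \<Rightarrow> real"
    using that by (auto intro!: integral_nonneg_AE elim!: eventually_mono)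
  note E0 = this[OF v0] this[OF w0]
  have ki: "integrable I0 (\<lambda>s. Phi_kernel t s * \<bar>v s - w s\<bar>)"
    and keq: "(\<integral>s. Phi_kernel t s * \<bar>v s - w s\<bar> \<partial>I0) = (1 / (3 * pi) * (\<integral>s. K s t * \<bar>v s - w s\<bar> \<partial>I0)
      + (\<integral>s. indicator {..t} s * \<bar>v s - w s\<bar> \<partial>I0)) / (sqrt_tan t)\<^sup>2"
  proof -
    have *: "Phi_kernel t s * \<bar>v s - w s\<bar> = (1 / (3 * pi) * (K s t * \<bar>v s - w s\<bar>)
        + indicator {..t} s * \<bar>v s - w s\<bar>) / (sqrt_tan t)\<^sup>2" for s
      by (simp add: Phi_kernel_def distrib_right)
    show "integrable I0 (\<lambda>s. Phi_kernel t s * \<bar>v s - w s\<bar>)"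
      unfolding * using Ki Ii by (intro integrable_divide Bochner_Integration.integrable_add integrable_mult_right) auto
    show "(\<integral>s. Phi_kernel t s * \<bar>v s - w s\<bar> \<partial>I0) = (1 / (3 * pi) * (\<integral>s. K s t * \<bar>v s - w s\<bar> \<partial>I0)
      + (\<integral>s. indicator {..t} s * \<bar>v s - w s\<bar> \<partial>I0)) / (sqrt_tan t)\<^sup>2"
      unfolding * integral_divide_zero using Ki Ii
      by (subst Bochner_Integration.integral_add) auto
  qed
  have "\<bar>Phi \<alpha> v t - Phi \<alpha> w t\<bar> = 3 / (\<alpha> * pi) / (sqrt_tan t)\<^sup>2 *
      \<bar>sin (t + H v t / 3) / exp (?E v) - sin (t + H w t / 3) / exp (?E w)\<bar>"
    unfolding Phi_eq[OF t v] Phi_eq[OF t w] right_diff_distrib[symmetric] abs_mult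
    using \<alpha> by simp
  also have "\<dots> \<le> 3 / (\<alpha> * pi) / (sqrt_tan t)\<^sup>2 * (\<bar>(t + H v t / 3) - (t + H w t / 3)\<bar> + \<bar>?E v - ?E w\<bar>)"
    using \<alpha> by (intro mult_left_mono abs_sin_mult_exp_diff_le E0) auto
  also have "\<dots> \<le> 3 / (\<alpha> * pi) / (sqrt_tan t)\<^sup>2 * (1 / (3 * pi) * (\<integral>s. K s t * \<bar>v s - w s\<bar> \<partial>I0)
      + (\<integral>s. indicator {..t} s * \<bar>v s - w s\<bar> \<partial>I0))"
  proof (intro mult_left_mono add_mono dE)
    have "\<bar>(t + H v t / 3) - (t + H w t / 3)\<bar> = \<bar>H v t - H w t\<bar> / 3"
      by (auto simp: abs_if)
    also have "\<dots> \<le> 1 / (3 * pi) * (\<integral>s. K s t * \<bar>v s - w s\<bar> \<partial>I0)"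
      using dH by (simp add: field_simps)
    finally show "\<bar>(t + H v t / 3) - (t + H w t / 3)\<bar> \<le> 1 / (3 * pi) * (\<integral>s. K s t * \<bar>v s - w s\<bar> \<partial>I0)" .
  qed (use \<alpha> in auto)
  also have "\<dots> = 3 / (\<alpha> * pi) * (\<integral>s. Phi_kernel t s * \<bar>v s - w s\<bar> \<partial>I0)"
    unfolding keq by simp
  finally have "ennreal \<bar>Phi \<alpha> v t - Phi \<alpha> w t\<bar> \<le> ennreal (3 / (\<alpha> * pi) * (\<integral>s. Phi_kernel t s * \<bar>v s - w s\<bar> \<partial>I0))"
    by (rule ennreal_leI)
  also have "\<dots> = ennreal (3 / (\<alpha> * pi)) * ennreal (\<integral>s. Phi_kernel t s * \<bar>v s - w s\<bar> \<partial>I0)"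
    using \<alpha> by (intro ennreal_mult') auto
  also have "ennreal (\<integral>s. Phi_kernel t s * \<bar>v s - w s\<bar> \<partial>I0) = (\<integral>\<^sup>+s. ennreal (Phi_kernel t s * \<bar>v s - w s\<bar>) \<partial>I0)"
    using t by (intro nn_integral_eq_integral[symmetric] ki) (auto intro!: AE_I2 mult_nonneg_nonneg Phi_kernel_nonneg)
  finally show ?thesis .
qed

section \<open>Existence and uniqueness of the fixed point\<close>

text \<open>The bounds hold at every point rather than almost everywhere, so that the iteration can
  be followed point by point and its limit inherits them.\<close>

definition below_weight :: "(real \<Rightarrow> real) \<Rightarrow> bool" where
  "below_weight w \<longleftrightarrow> w \<in> borel_measurable I0 \<and> (\<forall>s\<in>{0<..<pi/2}. 0 \<le> w s \<and> w s \<le> 1 / sqrt_tan s)"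

lemma below_weight_finite:
  assumes w: "below_weight w" and t: "0 < t" "t < pi / 2"
  shows "(\<integral>\<^sup>+s. ennreal (Phi_kernel t s * \<bar>w s\<bar>) \<partial>I0) < \<infinity>"
proof -
  have "(\<integral>\<^sup>+s. ennreal (Phi_kernel t s * \<bar>w s\<bar>) \<partial>I0) \<le> (\<integral>\<^sup>+s. ennreal (Phi_kernel t s * (1 / sqrt_tan s)) \<partial>I0)"
    using w t by (intro nn_integral_mono ennreal_leI mult_left_mono)
      (auto simp: below_weight_def intro!: Phi_kernel_nonneg)
  also have "\<dots> \<le> ennreal (8 / 3 * (1 / sqrt_tan t))" by (rule Phi_kernel_row[OF t])
  also have "\<dots> < \<infinity>" by simp
  finally show ?thesis .
qed

text \<open>The two upper bounds serve opposite ends of the interval and cross at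
  \<open>sqrt_tan t = 1\<close>, which yields H w <= 2. The first also gives the smallness near 0
  behind the invariance of the set. The last identity puts H into the form that the Schur test
  handles.\<close>

lemma H_below_weight:
  assumes w: "below_weight w" and t: "0 < t" "t < pi / 2"
  shows "0 \<le> H w t" "H w t \<le> 2 * sqrt_tan t" "H w t \<le> 2 / sqrt_tan t"
    and "ennreal (H w t) = ennreal (1 / pi) * (\<integral>\<^sup>+s. ennreal (K s t * w s) \<partial>I0)"
proof -
  have wm: "w \<in> borel_measurable I0" using w by (simp add: below_weight_def)
  have w0: "0 \<le> w s" "w s \<le> 1 / sqrt_tan s" "0 \<le> K s t" if "s \<in> space I0" for s
    using w t that by (auto simp: below_weight_def K_nonneg)
  have Kw: "0 \<le> K s t * w s" if "s \<in> space I0" for s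
    using w0[OF that] by simp
  have int0: "0 \<le> (\<integral>s. K s t * w s \<partial>I0)"
    by (intro integral_nonneg_AE AE_I2 Kw)
  then show "0 \<le> H w t" by (simp add: H_def)
  have eq: "ennreal (\<integral>s. K s t * w s \<partial>I0) = (\<integral>\<^sup>+s. ennreal (K s t * w s) \<partial>I0)"
    by (intro nn_integral_eq_integral[symmetric] K_integrable t wm below_weight_finite w AE_I2 Kw)
  then show "ennreal (H w t) = ennreal (1 / pi) * (\<integral>\<^sup>+s. ennreal (K s t * w s) \<partial>I0)"
    unfolding H_def by (subst ennreal_mult') auto
  have le: "ennreal (\<integral>s. K s t * w s \<partial>I0) \<le> (\<integral>\<^sup>+s. ennreal (K s t / sqrt_tan s) \<partial>I0)"
    unfolding eq
  proof (intro nn_integral_mono ennreal_leI)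
    fix s assume "s \<in> space I0"
    from mult_left_mono[OF w0(2)[OF this] w0(3)[OF this]] show "K s t * w s \<le> K s t / sqrt_tan s" by simp
  qed
  have r: "0 < sqrt_tan t" using t by simp
  have "(\<integral>s. K s t * w s \<partial>I0) \<le> 2 * pi * sqrt_tan t"
    using order_trans[OF le nn_integral_K_le(1)[OF t]] r by (subst (asm) ennreal_le_iff) auto
  then show "H w t \<le> 2 * sqrt_tan t" by (simp add: H_def field_simps)
  have "(\<integral>s. K s t * w s \<partial>I0) \<le> 2 * pi / sqrt_tan t"
    using order_trans[OF le nn_integral_K_le(2)[OF t]] r by (subst (asm) ennreal_le_iff) auto
  then have "1 / pi * (\<integral>s. K s t * w s \<partial>I0) \<le> 1 / pi * (2 * pi / sqrt_tan t)"
    by (intro mult_left_mono) auto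
  then show "H w t \<le> 2 / sqrt_tan t" by (simp add: H_def)
qed

lemma Phi_below_weight_bounds:
  assumes \<alpha>: "0 < \<alpha>" and w: "below_weight w" and t: "0 < t" "t < pi / 2"
  shows "0 \<le> Phi \<alpha> w t"
    and "Phi \<alpha> w t \<le> 3 / (\<alpha> * pi) / (sqrt_tan t)\<^sup>2 * (sin t + H w t / 3)"
proof -
  let ?E = "\<integral>s. indicator {..t} s * w s \<partial>I0"
  have wm: "w \<in> borel_measurable I0" and w0: "\<And>s. s \<in> space I0 \<Longrightarrow> 0 \<le> w s"
    using w by (auto simp: below_weight_def)
  note H = H_below_weight[OF w t]
  have r: "0 < sqrt_tan t" using t by simp
  \<comment> \<open>Then t + H w t / 3 is below pi/2 + 2/3 < pi, so the sine cannot become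
    negative.\<close>
  have "H w t \<le> 2"
  proof (cases "sqrt_tan t \<le> 1")
    case False
    then have "2 / sqrt_tan t \<le> 2" using r by (simp add: divide_le_eq)
    then show ?thesis using H(3) by linarith
  qed (use H(2) in linarith)
  then have "t + H w t / 3 \<le> pi" using t pi_gt3 by linarith
  then have sin0: "0 \<le> sin (t + H w t / 3)"
    using t H(1) by (intro sin_ge_zero) auto
  have E: "0 \<le> ?E" by (intro integral_nonneg_AE AE_I2) (use w0 in auto)
  show "0 \<le> Phi \<alpha> w t"
    unfolding Phi_eq[OF t wm] using \<alpha> sin0 by simp
  have "sin (t + H w t / 3) / exp ?E \<le> sin (t + H w t / 3) / 1"
    using sin0 E by (intro divide_left_mono) auto
  also have "\<dots> \<le> sin t + H w t / 3"
  proof -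
    have "\<bar>t + H w t / 3 - t\<bar> = H w t / 3" using H(1) by simp
    then show ?thesis using abs_sin_diff_le[of "t + H w t / 3" t] by linarith
  qed
  finally show "Phi \<alpha> w t \<le> 3 / (\<alpha> * pi) / (sqrt_tan t)\<^sup>2 * (sin t + H w t / 3)"
    unfolding Phi_eq[OF t wm] using \<alpha> by (intro mult_left_mono) auto
qed

section \<open>Invariance and contraction for \<alpha> > 8/pi\<close>

lemma Phi_coefficient:
  assumes "\<alpha> > 8 / pi"
  shows "0 < \<alpha>" "3 / (\<alpha> * pi) \<le> 3 / 8" "0 < 3 / (\<alpha> * pi)" "8 / (\<alpha> * pi) < 1"
proof -
  have "8 < \<alpha> * pi" using assms by (simp add: field_simps)
  then show "3 / (\<alpha> * pi) \<le> 3 / 8" "0 < 3 / (\<alpha> * pi)" "8 / (\<alpha> * pi) < 1"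
    by (auto simp: field_simps)
  have "0 < 8 / pi" by simp
  then show "0 < \<alpha>" using assms by linarith
qed

text \<open>Since sin t <= min(1, tan t) <= \<open>sqrt_tan t\<close>, the sum sin t + H w t / 3 is
  at most (1 + 2/3) \<open>sqrt_tan t\<close>. The coefficient is at most 3/8, so the image lies
  below 5/8 of the weight.\<close>

lemma below_weight_Phi:
  assumes \<alpha>: "\<alpha> > 8 / pi" and w: "below_weight w"
  shows "below_weight (Phi \<alpha> w)"
  unfolding below_weight_def
proof (intro conjI ballI)
  show "Phi \<alpha> w \<in> borel_measurable I0"
    using w by (intro borel_measurable_Phi) (simp add: below_weight_def)
  fix t assume "t \<in> {0<..<pi/2}"
  then have t: "0 < t" "t < pi / 2" by auto
  note c = Phi_coefficient[OF \<alpha>]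
  show "0 \<le> Phi \<alpha> w t" by (rule Phi_below_weight_bounds[OF c(1) w t])
  have r: "0 < sqrt_tan t" using t by simp
  have "0 < cos t" "0 < sin t" using t by (auto intro: cos_gt_zero sin_gt_zero)
  then have "sin t \<le> tan t" by (simp add: tan_def field_simps)
  then have "sin t \<le> (sqrt_tan t)\<^sup>2" using t by (simp add: sqrt_tan_square)
  have "sin t \<le> sqrt_tan t"
  proof (cases "sqrt_tan t \<le> 1")
    case True
    then have "(sqrt_tan t)\<^sup>2 \<le> sqrt_tan t" using r by (simp add: power2_eq_square mult_left_le_one_le)
    then show ?thesis using \<open>sin t \<le> (sqrt_tan t)\<^sup>2\<close> by linarith
  next
    case False
    then show ?thesis using sin_le_one[of t] by linarith
  qed
  then have "sin t + H w t / 3 \<le> 5 / 3 * sqrt_tan t"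
    using H_below_weight(2)[OF w t] by linarith
  then have "3 / (\<alpha> * pi) / (sqrt_tan t)\<^sup>2 * (sin t + H w t / 3) \<le> 3 / 8 / (sqrt_tan t)\<^sup>2 * (5 / 3 * sqrt_tan t)"
    using \<open>0 < sin t\<close> H_below_weight(1)[OF w t] by (intro mult_mono divide_right_mono c(2)) auto
  also have "\<dots> \<le> 1 / sqrt_tan t"
    using r by (simp add: power2_eq_square field_simps)
  finally show "Phi \<alpha> w t \<le> 1 / sqrt_tan t"
    using Phi_below_weight_bounds(2)[OF c(1) w t] by linarith
qed

text \<open>The row condition says that the kernel maps the weight to at most 8/3 times itself.
  Hence a bound D relative to the weight is multiplied by at most 3 / (\<alpha> pi) * 8/3.\<close>

lemma Phi_weighted_contraction:
  assumes \<alpha>: "0 < \<alpha>" and v: "below_weight v" and w: "below_weight w" and D: "0 \<le> D"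
    and le: "\<And>s. s \<in> {0<..<pi/2} \<Longrightarrow> \<bar>v s - w s\<bar> \<le> D / sqrt_tan s"
    and t: "0 < t" "t < pi / 2"
  shows "\<bar>Phi \<alpha> v t - Phi \<alpha> w t\<bar> \<le> 8 / (\<alpha> * pi) * D / sqrt_tan t"
proof -
  have [measurable]: "(\<lambda>s. Phi_kernel t s * (1 / sqrt_tan s)) \<in> borel_measurable I0"
    unfolding Phi_kernel_def by (rule borel_measurable_I0) simp
  have r: "0 < sqrt_tan t" using t by simp
  have "(\<integral>\<^sup>+s. ennreal (Phi_kernel t s * \<bar>v s - w s\<bar>) \<partial>I0)
      \<le> (\<integral>\<^sup>+s. ennreal D * ennreal (Phi_kernel t s * (1 / sqrt_tan s)) \<partial>I0)"
  proof (rule nn_integral_mono)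
    fix s assume "s \<in> space I0"
    then have s: "s \<in> {0<..<pi/2}" by simp
    have "Phi_kernel t s * \<bar>v s - w s\<bar> \<le> Phi_kernel t s * (D / sqrt_tan s)"
      using s t by (intro mult_left_mono le Phi_kernel_nonneg) auto
    then show "ennreal (Phi_kernel t s * \<bar>v s - w s\<bar>) \<le> ennreal D * ennreal (Phi_kernel t s * (1 / sqrt_tan s))"
      using D by (subst ennreal_mult'[symmetric]) (auto simp: mult_ac intro: ennreal_leI)
  qed
  also have "\<dots> = ennreal D * (\<integral>\<^sup>+s. ennreal (Phi_kernel t s * (1 / sqrt_tan s)) \<partial>I0)"
    by (rule nn_integral_cmult) measurable
  also have "\<dots> \<le> ennreal D * ennreal (8 / 3 * (1 / sqrt_tan t))"
    by (intro mult_left_mono Phi_kernel_row t) simp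
  finally have *: "(\<integral>\<^sup>+s. ennreal (Phi_kernel t s * \<bar>v s - w s\<bar>) \<partial>I0) \<le> ennreal D * ennreal (8 / 3 * (1 / sqrt_tan t))" .
  have "ennreal \<bar>Phi \<alpha> v t - Phi \<alpha> w t\<bar>
      \<le> ennreal (3 / (\<alpha> * pi)) * (\<integral>\<^sup>+s. ennreal (Phi_kernel t s * \<bar>v s - w s\<bar>) \<partial>I0)"
    by (rule Phi_diff_le[OF \<alpha> t _ _ _ _ below_weight_finite[OF v t] below_weight_finite[OF w t]])
       (use v w in \<open>auto simp: below_weight_def intro!: AE_I2\<close>)
  also have "\<dots> \<le> ennreal (3 / (\<alpha> * pi)) * (ennreal D * ennreal (8 / 3 * (1 / sqrt_tan t)))"
    by (intro mult_left_mono *) simp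
  also have "\<dots> = ennreal (3 / (\<alpha> * pi) * (D * (8 / 3 * (1 / sqrt_tan t))))"
  proof -
    have "0 \<le> 3 / (\<alpha> * pi)" using \<alpha> by simp
    from ennreal_mult'[OF this] ennreal_mult'[OF D] show ?thesis by (simp only:)
  qed
  also have "3 / (\<alpha> * pi) * (D * (8 / 3 * (1 / sqrt_tan t))) = 8 / (\<alpha> * pi) * D / sqrt_tan t"
    by simp
  finally show ?thesis
    using \<alpha> D r by (subst (asm) ennreal_le_iff) auto
qed

text \<open>With x = cot t * H w t one has 0 <= Phi <= 3/8 (1 + x/3), so its square is at most 9/32
  (1 + x^2/9). The interval has length pi/2 and the integral of x^2 is at most 4, by
  \<open>K_L2_bound\<close> divided by pi^2. This gives 9/32 (pi/2 + 4/9), which is below 1 already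
  by pi < 4.\<close>

lemma Phi_preserves_L2_bound:
  assumes \<alpha>: "\<alpha> > 8 / pi" and w: "below_weight w"
    and le: "(\<integral>\<^sup>+s. ennreal ((w s)\<^sup>2) \<partial>I0) \<le> 1"
  shows "(\<integral>\<^sup>+s. ennreal ((Phi \<alpha> w s)\<^sup>2) \<partial>I0) \<le> 1"
proof -
  interpret sigma_finite_measure I0 by (rule sigma_finite_I0)
  have wm [measurable]: "w \<in> borel_measurable I0" and w0: "\<And>s. s \<in> space I0 \<Longrightarrow> 0 \<le> w s"
    using w by (auto simp: below_weight_def)
  define N where "N t = (\<integral>\<^sup>+s. ennreal (K s t / (sqrt_tan t)\<^sup>2 * w s) \<partial>I0)" for t
  have [measurable]: "(\<lambda>(t, s). K s t / (sqrt_tan t)\<^sup>2) \<in> borel_measurable (I0 \<Otimes>\<^sub>M I0)"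
    by (rule borel_measurable_pair_I0) simp
  have [measurable]: "N \<in> borel_measurable I0"
    unfolding N_def[abs_def] by measurable
  have bound: "ennreal ((Phi \<alpha> w t)\<^sup>2) \<le> ennreal (9 / 32) * (1 + ennreal (1 / (9 * pi\<^sup>2)) * (N t)\<^sup>2)"
    if "t \<in> space I0" for t
  proof -
    have t: "0 < t" "t < pi / 2" using that by auto
    have r: "0 < sqrt_tan t" using t by simp
    note c = Phi_coefficient[OF \<alpha>] and H = H_below_weight[OF w t]
    define x where "x = H w t / (sqrt_tan t)\<^sup>2"
    have x: "0 \<le> x" unfolding x_def using H(1) by simp
    have [measurable]: "(\<lambda>s. K s t) \<in> borel_measurable I0"
      by (rule borel_measurable_I0) simp
    have "N t = (\<integral>\<^sup>+s. ennreal (1 / (sqrt_tan t)\<^sup>2) * ennreal (K s t * w s) \<partial>I0)"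
      unfolding N_def by (intro nn_integral_cong, subst ennreal_mult'[symmetric]) auto
    also have "\<dots> = ennreal (1 / (sqrt_tan t)\<^sup>2) * (\<integral>\<^sup>+s. ennreal (K s t * w s) \<partial>I0)"
      by (rule nn_integral_cmult) measurable
    finally have "ennreal (1 / pi) * N t = ennreal (1 / (sqrt_tan t)\<^sup>2) * ennreal (H w t)"
      unfolding H(4) by (simp only: mult_ac)
    also have "\<dots> = ennreal x"
      unfolding x_def by (subst ennreal_mult'[symmetric]) auto
    finally have Nx: "ennreal (1 / pi) * N t = ennreal x" .
    have "0 < cos t" "0 < sin t" using t by (auto intro: cos_gt_zero sin_gt_zero)
    then have cos: "cos t = sin t / (sqrt_tan t)\<^sup>2"
      using t by (simp add: sqrt_tan_square tan_def)
    have "3 / (\<alpha> * pi) / (sqrt_tan t)\<^sup>2 * (sin t + H w t / 3) = 3 / (\<alpha> * pi) * (cos t + x / 3)"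
      unfolding x_def cos by (simp add: algebra_simps add_divide_distrib)
    then have "Phi \<alpha> w t \<le> 3 / (\<alpha> * pi) * (cos t + x / 3)"
      using Phi_below_weight_bounds(2)[OF c(1) w t] by simp
    also have "\<dots> \<le> 3 / 8 * (1 + x / 3)"
      using x \<open>0 < cos t\<close> by (intro mult_mono c(2)) auto
    finally have "(Phi \<alpha> w t)\<^sup>2 \<le> (3 / 8 * (1 + x / 3))\<^sup>2"
      using Phi_below_weight_bounds(1)[OF c(1) w t] by (intro power_mono)
    also have "\<dots> \<le> 9 / 32 * (1 + 1 / 9 * x\<^sup>2)"
      using sum_squares_bound[of 1 "x / 3"] by (simp add: power2_eq_square algebra_simps)
    finally have "ennreal ((Phi \<alpha> w t)\<^sup>2) \<le> ennreal (9 / 32 * (1 + 1 / 9 * x\<^sup>2))"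
      by (rule ennreal_leI)
    also have "\<dots> = ennreal (9 / 32) * (1 + ennreal (1 / 9) * (ennreal x)\<^sup>2)"
    proof -
      have "ennreal (9 / 32 * (1 + 1 / 9 * x\<^sup>2)) = ennreal (9 / 32) * ennreal (1 + 1 / 9 * x\<^sup>2)"
        by (rule ennreal_mult') simp
      also have "ennreal (1 + 1 / 9 * x\<^sup>2) = ennreal 1 + ennreal (1 / 9 * x\<^sup>2)"
        by (rule ennreal_plus) auto
      also have "ennreal (1 / 9 * x\<^sup>2) = ennreal (1 / 9) * ennreal (x\<^sup>2)"
        by (rule ennreal_mult') simp
      finally show ?thesis using x by (simp add: ennreal_power)
    qed
    also have "(ennreal x)\<^sup>2 = ennreal (1 / pi\<^sup>2) * (N t)\<^sup>2"
      unfolding Nx[symmetric] power_mult_distrib by (simp add: ennreal_power power_divide)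
    also have "ennreal (1 / 9) * (ennreal (1 / pi\<^sup>2) * (N t)\<^sup>2) = ennreal (1 / (9 * pi\<^sup>2)) * (N t)\<^sup>2"
      unfolding mult.assoc[symmetric] by (subst ennreal_mult'[symmetric]) auto
    finally show ?thesis .
  qed
  have "(\<integral>\<^sup>+t. ennreal ((Phi \<alpha> w t)\<^sup>2) \<partial>I0)
      \<le> (\<integral>\<^sup>+t. ennreal (9 / 32) * (1 + ennreal (1 / (9 * pi\<^sup>2)) * (N t)\<^sup>2) \<partial>I0)"
    by (intro nn_integral_mono bound)
  also have "\<dots> = ennreal (9 / 32) * (emeasure I0 (space I0) + ennreal (1 / (9 * pi\<^sup>2)) * (\<integral>\<^sup>+t. (N t)\<^sup>2 \<partial>I0))"
    by (simp add: nn_integral_cmult nn_integral_add)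
  also have "\<dots> \<le> ennreal (9 / 32) * (ennreal (pi / 2) + ennreal (1 / (9 * pi\<^sup>2)) * ennreal ((2 * pi)\<^sup>2))"
  proof (intro mult_left_mono add_mono)
    show "emeasure I0 (space I0) \<le> ennreal (pi / 2)"
      by (simp add: emeasure_restrict_space)
    have "(\<integral>\<^sup>+t. (N t)\<^sup>2 \<partial>I0) \<le> ennreal ((2 * pi)\<^sup>2) * (\<integral>\<^sup>+s. ennreal ((w s)\<^sup>2) \<partial>I0)"
      unfolding N_def by (rule K_L2_bound) (use wm w0 in auto)
    also have "\<dots> \<le> ennreal ((2 * pi)\<^sup>2) * 1" by (intro mult_left_mono le) simp
    finally show "(\<integral>\<^sup>+t. (N t)\<^sup>2 \<partial>I0) \<le> ennreal ((2 * pi)\<^sup>2)" by simp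
  qed auto
  also have "\<dots> = ennreal (9 / 32 * (pi / 2 + 1 / (9 * pi\<^sup>2) * (2 * pi)\<^sup>2))"
    by (simp add: ennreal_mult'[symmetric] ennreal_plus[symmetric] del: ennreal_plus)
  also have "\<dots> \<le> ennreal 1"
    using pi_less_4 by (intro ennreal_leI) (simp add: power2_eq_square)
  finally show ?thesis by simp
qed

section \<open>Convergence of the iteration, and uniqueness\<close>

lemma Phi_fixed_point_exists:
  assumes \<alpha>: "\<alpha> > 8 / pi"
  shows "\<exists>z. below_weight z \<and> (\<integral>\<^sup>+s. ennreal ((z s)\<^sup>2) \<partial>I0) \<le> 1 \<and> (\<forall>t\<in>{0<..<pi/2}. Phi \<alpha> z t = z t)"
proof -
  note c = Phi_coefficient[OF \<alpha>]
  define q where "q = 8 / (\<alpha> * pi)"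
  have q: "0 \<le> q" "q < 1" using c by (auto simp: q_def)
  define z where "z n = (Phi \<alpha> ^^ n) (\<lambda>_. 0)" for n
  have z0: "z 0 = (\<lambda>_. 0)" and zS: "z (Suc n) = Phi \<alpha> (z n)" for n by (auto simp: z_def)
  have bw: "below_weight (z n)" for n
  proof (induction n)
    case 0
    show ?case by (auto simp: z0 below_weight_def less_imp_le)
  qed (auto simp: zS intro: below_weight_Phi \<alpha>)
  have L2: "(\<integral>\<^sup>+s. ennreal ((z n s)\<^sup>2) \<partial>I0) \<le> 1" for n
    by (induction n) (auto simp: z0 zS intro!: Phi_preserves_L2_bound \<alpha> bw)
  \<comment> \<open>Treating all k at once gives the Cauchy estimate without summing a geometric
    series: since z 0 = 0, the case n = 0 is the weight bound on z k, and each further step costs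
    one factor q.\<close>
  have diff: "\<bar>z (n + k) t - z n t\<bar> \<le> q ^ n / sqrt_tan t" if "t \<in> {0<..<pi/2}" for n k t
    using that
  proof (induction n arbitrary: t)
    case 0
    then show ?case using bw[of k] by (auto simp: z0 below_weight_def)
  next
    case (Suc n)
    have "\<bar>Phi \<alpha> (z (n + k)) t - Phi \<alpha> (z n) t\<bar> \<le> 8 / (\<alpha> * pi) * q ^ n / sqrt_tan t"
      by (rule Phi_weighted_contraction[OF c(1) bw bw]) (use Suc q in auto)
    then show ?case by (simp add: zS q_def)
  qed
  have qlim: "(\<lambda>n. q ^ n / sqrt_tan t) \<longlonglongrightarrow> 0" for t
    using LIMSEQ_power_zero[of q] q by (intro tendsto_divide_zero) auto
  define \<zeta> where "\<zeta> t = lim (\<lambda>n. z n t)" for t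
  have lim: "(\<lambda>n. z n t) \<longlonglongrightarrow> \<zeta> t" if t: "t \<in> {0<..<pi/2}" for t
  proof -
    have "Cauchy (\<lambda>n. z n t)"
    proof (rule CauchyI')
      fix e :: real assume "0 < e"
      from order_tendstoD(2)[OF qlim this, of t] obtain n0 where n0: "\<And>n. n \<ge> n0 \<Longrightarrow> q ^ n / sqrt_tan t < e"
        by (auto simp: eventually_sequentially)
      show "\<exists>M. \<forall>m\<ge>M. \<forall>n>m. dist (z m t) (z n t) < e"
      proof (intro exI[of _ n0] allI impI)
        fix m n assume "n0 \<le> m" "m < n"
        then show "dist (z m t) (z n t) < e"
          using diff[OF t, of m "n - m"] n0[of m] by (simp add: dist_real_def abs_minus_commute)
      qed
    qed
    then show ?thesis unfolding \<zeta>_def by (simp add: Cauchy_convergent convergent_LIMSEQ_iff[symmetric])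
  qed
  have diff_lim: "\<bar>\<zeta> t - z n t\<bar> \<le> q ^ n / sqrt_tan t" if t: "t \<in> {0<..<pi/2}" for t n
  proof (rule tendsto_upperbound)
    show "(\<lambda>k. \<bar>z (k + n) t - z n t\<bar>) \<longlonglongrightarrow> \<bar>\<zeta> t - z n t\<bar>"
      by (intro tendsto_intros LIMSEQ_ignore_initial_segment lim t)
    show "\<forall>\<^sub>F k in sequentially. \<bar>z (k + n) t - z n t\<bar> \<le> q ^ n / sqrt_tan t"
      using diff[OF t, of n] by (auto simp: add.commute)
  qed simp
  have bw\<zeta>: "below_weight \<zeta>"
    unfolding below_weight_def
  proof (intro conjI ballI)
    show "\<zeta> \<in> borel_measurable I0"
      by (rule borel_measurable_LIMSEQ_real[of _ z]) (use lim bw in \<open>auto simp: below_weight_def\<close>)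
    fix t assume t: "t \<in> {0<..<pi/2}"
    show "0 \<le> \<zeta> t"
      by (rule tendsto_lowerbound[OF lim[OF t]]) (use bw t in \<open>auto simp: below_weight_def\<close>)
    show "\<zeta> t \<le> 1 / sqrt_tan t"
      by (rule tendsto_upperbound[OF lim[OF t]]) (use bw t in \<open>auto simp: below_weight_def\<close>)
  qed
  have "Phi \<alpha> \<zeta> t = \<zeta> t" if t: "t \<in> {0<..<pi/2}" for t
  proof -
    \<comment> \<open>Both \<open>Phi \<alpha> \<zeta>\<close> and \<open>\<zeta>\<close> lie within
      q^(n+1) times the weight of z (Suc n): the former by contraction, the latter by
      \<open>diff_lim\<close>.\<close>
    have "\<bar>Phi \<alpha> \<zeta> t - \<zeta> t\<bar> \<le> 2 * q * (q ^ n / sqrt_tan t)" for n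
    proof -
      have "\<bar>Phi \<alpha> \<zeta> t - z (Suc n) t\<bar> \<le> q * q ^ n / sqrt_tan t"
        unfolding zS
        by (rule Phi_weighted_contraction[OF c(1) bw\<zeta> bw, folded q_def]) (use t q diff_lim in auto)
      moreover have "\<bar>\<zeta> t - z (Suc n) t\<bar> \<le> q * q ^ n / sqrt_tan t"
        using diff_lim[OF t, of "Suc n"] by simp
      moreover have "2 * q * (q ^ n / sqrt_tan t) = 2 * (q * q ^ n / sqrt_tan t)" by simp
      ultimately show ?thesis by linarith
    qed
    moreover have "(\<lambda>n. 2 * q * (q ^ n / sqrt_tan t)) \<longlonglongrightarrow> 0"
      using tendsto_mult_right_zero[OF qlim] .
    ultimately have "\<bar>Phi \<alpha> \<zeta> t - \<zeta> t\<bar> \<le> 0"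
      by (intro LIMSEQ_le_const) auto
    then show ?thesis by simp
  qed
  moreover have "(\<integral>\<^sup>+s. ennreal ((\<zeta> s)\<^sup>2) \<partial>I0) \<le> 1"
  proof -
    have "(\<integral>\<^sup>+s. ennreal ((\<zeta> s)\<^sup>2) \<partial>I0) = (\<integral>\<^sup>+s. liminf (\<lambda>n. ennreal ((z n s)\<^sup>2)) \<partial>I0)"
      by (intro nn_integral_cong lim_imp_Liminf[symmetric]) (auto intro!: tendsto_intros lim)
    also have "\<dots> \<le> liminf (\<lambda>n. \<integral>\<^sup>+s. ennreal ((z n s)\<^sup>2) \<partial>I0)"
    proof -
      have [measurable]: "z n \<in> borel_measurable I0" for n
        using bw by (simp add: below_weight_def)
      show ?thesis by (rule nn_integral_liminf) measurable
    qed
    also have "\<dots> \<le> 1"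
      by (rule Liminf_le) (auto simp: L2)
    finally show ?thesis .
  qed
  ultimately show ?thesis using bw\<zeta> by blast
qed

lemma Phi_fixed_point_unique:
  assumes \<alpha>: "\<alpha> > 8 / pi"
    and v: "L2 v" "AE s in I0. 0 \<le> v s" "AE s in I0. v s = Phi \<alpha> v s"
    and w: "L2 w" "AE s in I0. 0 \<le> w s" "AE s in I0. w s = Phi \<alpha> w s"
  shows "AE s in I0. v s = w s"
proof -
  interpret sigma_finite_measure I0 by (rule sigma_finite_I0)
  note c = Phi_coefficient[OF \<alpha>]
  note [measurable] = Phi_kernel_measurable
  have vm [measurable]: "v \<in> borel_measurable I0" and wm [measurable]: "w \<in> borel_measurable I0"
    and sq: "integrable I0 (\<lambda>s. (v s)\<^sup>2)" "integrable I0 (\<lambda>s. (w s)\<^sup>2)"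
    using v w by (auto simp: L2_def)
  \<comment> \<open>The Schur bound applied to |u| makes the square of the inner integral integrable
    in t, hence finite for almost every t. There the Lipschitz estimate is applicable.\<close>
  have fin: "AE t in I0. (\<integral>\<^sup>+s. ennreal (Phi_kernel t s * \<bar>u s\<bar>) \<partial>I0) < \<infinity>"
    if [measurable]: "u \<in> borel_measurable I0" and "integrable I0 (\<lambda>s. (u s)\<^sup>2)" for u
  proof -
    have "(\<integral>\<^sup>+t. (\<integral>\<^sup>+s. ennreal (Phi_kernel t s * \<bar>u s\<bar>) \<partial>I0)\<^sup>2 \<partial>I0)
        \<le> ennreal ((8/3)\<^sup>2) * (\<integral>\<^sup>+s. ennreal (\<bar>u s\<bar>\<^sup>2) \<partial>I0)"
      by (rule Phi_kernel_L2_bound) auto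
    also have "\<dots> < \<infinity>"
      using that(2) by (simp add: nn_integral_eq_integral ennreal_mult_less_top)
    finally have "AE t in I0. (\<integral>\<^sup>+s. ennreal (Phi_kernel t s * \<bar>u s\<bar>) \<partial>I0)\<^sup>2 \<noteq> \<infinity>"
      by (intro nn_integral_PInf_AE) auto
    then show ?thesis
      by eventually_elim (auto simp: less_top power2_eq_square ennreal_mult_eq_top_iff)
  qed
  let ?f = "\<lambda>s. \<bar>v s - w s\<bar>"
  let ?I = "\<integral>\<^sup>+s. ennreal ((?f s)\<^sup>2) \<partial>I0"
  have "AE t in I0. t \<in> space I0" by (rule AE_space)
  then have "AE t in I0. ennreal ((?f t)\<^sup>2)
      \<le> ennreal ((3 / (\<alpha> * pi))\<^sup>2) * (\<integral>\<^sup>+s. ennreal (Phi_kernel t s * ?f s) \<partial>I0)\<^sup>2"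
    using v(3) w(3) fin[OF vm sq(1)] fin[OF wm sq(2)]
  proof eventually_elim
    case (elim t)
    then have t: "0 < t" "t < pi / 2" by auto
    have "ennreal (?f t) \<le> ennreal (3 / (\<alpha> * pi)) * (\<integral>\<^sup>+s. ennreal (Phi_kernel t s * ?f s) \<partial>I0)"
      using Phi_diff_le[OF c(1) t vm wm v(2) w(2) elim(4,5)] elim(2,3) by simp
    then have "(ennreal (?f t))\<^sup>2 \<le> (ennreal (3 / (\<alpha> * pi)) * (\<integral>\<^sup>+s. ennreal (Phi_kernel t s * ?f s) \<partial>I0))\<^sup>2"
      by (intro power_mono) auto
    then show ?case
      using c(3) unfolding power_mult_distrib by (simp add: ennreal_power)
  qed
  then have "?I \<le> (\<integral>\<^sup>+t. ennreal ((3 / (\<alpha> * pi))\<^sup>2) * (\<integral>\<^sup>+s. ennreal (Phi_kernel t s * ?f s) \<partial>I0)\<^sup>2 \<partial>I0)"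
    by (rule nn_integral_mono_AE)
  also have "\<dots> = ennreal ((3 / (\<alpha> * pi))\<^sup>2) * (\<integral>\<^sup>+t. (\<integral>\<^sup>+s. ennreal (Phi_kernel t s * ?f s) \<partial>I0)\<^sup>2 \<partial>I0)"
    by (rule nn_integral_cmult) measurable
  also have "\<dots> \<le> ennreal ((3 / (\<alpha> * pi))\<^sup>2) * (ennreal ((8/3)\<^sup>2) * ?I)"
    by (intro mult_left_mono Phi_kernel_L2_bound) auto
  also have "\<dots> = ennreal ((8 / (\<alpha> * pi))\<^sup>2) * ?I"
  proof -
    have "(3 / (\<alpha> * pi))\<^sup>2 * (8/3)\<^sup>2 = (8 / (\<alpha> * pi))\<^sup>2"
      by (simp add: power2_eq_square)
    then show ?thesis
      by (simp only: mult.assoc[symmetric] ennreal_mult'[OF zero_le_power2, symmetric])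
  qed
  finally have le: "?I \<le> ennreal ((8 / (\<alpha> * pi))\<^sup>2) * ?I" .
  \<comment> \<open>The inequality \<open>le\<close> would also be satisfied by an infinite
    integral. Finiteness allows passing to a real number J with J <= q^2 J, where q = 8 / (\<alpha>
    pi) < 1, and forces J = 0.\<close>
  have "integrable I0 (\<lambda>s. (?f s)\<^sup>2)"
  proof (rule Bochner_Integration.integrable_bound)
    show "integrable I0 (\<lambda>s. 2 * (v s)\<^sup>2 + 2 * (w s)\<^sup>2)"
      using sq by (intro Bochner_Integration.integrable_add integrable_mult_right)
    have "(x - y)\<^sup>2 \<le> 2 * x\<^sup>2 + 2 * y\<^sup>2" for x y :: real
      using sum_squares_bound[of x "- y"] by (simp add: power2_eq_square algebra_simps)
    then show "AE s in I0. norm ((?f s)\<^sup>2) \<le> norm (2 * (v s)\<^sup>2 + 2 * (w s)\<^sup>2)"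
      by simp
  qed measurable
  then have I: "?I = ennreal (\<integral>s. (?f s)\<^sup>2 \<partial>I0)" by (intro nn_integral_eq_integral) auto
  define J where "J = (\<integral>s. (?f s)\<^sup>2 \<partial>I0)"
  have J: "0 \<le> J" unfolding J_def by simp
  have "ennreal J \<le> ennreal ((8 / (\<alpha> * pi))\<^sup>2 * J)"
    using le unfolding I J_def[symmetric] by (subst ennreal_mult') auto
  then have "J \<le> (8 / (\<alpha> * pi))\<^sup>2 * J" using J by (subst (asm) ennreal_le_iff) auto
  moreover have "(8 / (\<alpha> * pi))\<^sup>2 < 1"
    using c by (intro power_less_one_iff[THEN iffD2]) auto
  ultimately have "J = 0"
    using J mult_strict_right_mono[of "(8 / (\<alpha> * pi))\<^sup>2" 1 J] by (cases "J = 0") auto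
  then have "?I = 0" unfolding I J_def by simp
  then show ?thesis
    by (subst (asm) nn_integral_0_iff_AE) (auto elim!: eventually_mono)
qed

theorem theorem3p8:
  fixes \<alpha> :: real
  assumes "\<alpha> > 8 / pi"
  shows "\<exists>\<zeta>. L2 \<zeta> \<and> (AE \<sigma> in I0. \<zeta> \<sigma> \<ge> 0) \<and> (AE \<sigma> in I0. \<zeta> \<sigma> = Phi \<alpha> \<zeta> \<sigma>)
           \<and> (\<forall>\<eta>. L2 \<eta> \<and> (AE \<sigma> in I0. \<eta> \<sigma> \<ge> 0) \<and> (AE \<sigma> in I0. \<eta> \<sigma> = Phi \<alpha> \<eta> \<sigma>)
                  \<longrightarrow> (AE \<sigma> in I0. \<eta> \<sigma> = \<zeta> \<sigma>))"
proof -
  obtain z where z: "below_weight z" "(\<integral>\<^sup>+s. ennreal ((z s)\<^sup>2) \<partial>I0) \<le> 1"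
      "\<forall>t\<in>{0<..<pi/2}. Phi \<alpha> z t = z t"
    using Phi_fixed_point_exists[OF assms] by blast
  have [measurable]: "z \<in> borel_measurable I0" using z(1) by (simp add: below_weight_def)
  have "integrable I0 (\<lambda>s. (z s)\<^sup>2)"
    using le_less_trans[OF z(2) ennreal_one_less_top] by (intro integrableI_bounded) auto
  then have "L2 z" by (simp add: L2_def)
  moreover have "AE s in I0. 0 \<le> z s" "AE s in I0. z s = Phi \<alpha> z s"
    using z by (auto simp: below_weight_def intro!: AE_I2)
  ultimately show ?thesis
    using Phi_fixed_point_unique[OF assms] by blast
qed

end
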